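(* Let $n\ge1$ be an integer and let $U,W:\mathbb R^n\to[0,\infty]$ be Lebesgue measurable. Define $u$ and $w$ on $(0,\infty)$ by $u=U^*$ and $1/w=(1/W)^*$. Suppose $1<p<\infty$ and $0<q<p$, and suppose that there is a finite constant $C_1$ such that $$\bigg(\int_0^\infty\bigg(\int_0^{1/t} f\bigg)^q u(t)\,dt\bigg)^{1/q}\le C_1\bigg(\int_0^\infty f^p w\bigg)^{1/p}$$ for all non-negative measurable $f$ on $(0,\infty)$. Suppose also that at least one of the following two statements holds: (1) there is a finite constant $C_2$ such that for all $f\in L^1(\mathbb R^n)$, $$\bigg(\int_0^\infty\bigg(x^{-1/2}\int_{1/x}^\infty t^{-1/2}f^*(t)\,dt\bigg)^q u(x)\,dx\bigg)^{1/q}\le C_2\bigg(\int_0^\infty (f^* )^p w\bigg)^{1/p};$$ (2) there is a finite constant $C_3$ such that for all $f\in L^1(\mathbb R^n)$, $$\bigg(\int_0^\infty\bigg(\frac1x\int_{1/x}^\infty (f^* )^2\bigg)^{q/2} u(x)\,dx\bigg)^{1/q}\le C_3\bigg(\int_0^\infty (f^* )^p w\bigg)^{1/p}.$$ Then there is a finite constant $C$ such that for all $f\in L^1(\mathbb R^n)$, $$\bigg(\int_0^\infty (\hat f)^*(t)^q u(t)\,dt\bigg)^{1/q}\le C\bigg(\int_0^\infty f^*(s)^p w(s)\,ds\bigg)^{1/p},$$ and hence also, for all $f\in L^1(\mathbb R^n)$, $$\bigg(\int_{\mathbb R^n}|\hat f(y)|^qU(y)\,dy\bigg)^{1/q}\le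 C\bigg(\int_{\mathbb R^n}|f(x)|^pW(x)\,dx\bigg)^{1/p}.$$
   Context: The Fourier transform of $f\in L^1(\mathbb R^n)$ is $\hat f(x)=\int_{\mathbb R^n}e^{-2\pi i x\cdot y}f(y)\,dy$. For a $\mu$-measurable function $f$, the non-increasing rearrangement is $f^*(t)=\inf\{\alpha>0:\mu_f(\alpha)\le t\}$, $t>0$, where $\mu_f(\alpha)=\mu\{x:|f(x)|>\alpha\}$; here $\mu$ is Lebesgue measure on $\mathbb R^n$. The functions $u$ and $w$ take values in $[0,\infty]$, $u$ is non-increasing and $w$ is non-decreasing. Usual conventions: $1/0=\infty$, $1/\infty=0$, $0\cdot\infty=0$. *)

theory Defs
  imports "HOL-Analysis.Analysis"
begin

text \<open>Powers on $[0,\infty]$, only meant for exponents \<open>r > 0\<close>: the value at \<open>\<infinity>\<close> is \<open>\<infinity>\<close>.\<close>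

definition ennpow :: "ennreal \<Rightarrow> real \<Rightarrow> ennreal"  (infixr "ennpow" 80) where
  "x ennpow r = (if x = \<infinity> then \<infinity> else ennreal (enn2real x powr r))"

text \<open>
  Distribution function and non-increasing rearrangement of a $[0,\infty]$-valued function.
  For complex functions they are applied to the modulus.  The rearrangement is meant
  for \<open>t > 0\<close>; \<open>Inf {} = \<infinity>\<close> gives the value \<open>\<infinity>\<close> when no \<open>\<alpha>\<close> is admissible.
\<close>

definition distr_fun :: "'a measure \<Rightarrow> ('a \<Rightarrow> ennreal) \<Rightarrow> real \<Rightarrow> ennreal" where
  "distr_fun M g \<alpha> = emeasure M {x \<in> space M. ennreal \<alpha> < g x}"

definition rearr :: "'a measure \<Rightarrow> ('a \<Rightarrow> ennreal) \<Rightarrow> real \<Rightarrow> ennreal" where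
  "rearr M g t = Inf {ennreal \<alpha> |\<alpha>. 0 < \<alpha> \<and> distr_fun M g \<alpha> \<le> ennreal t}"

definition crearr :: "(real ^ 'n \<Rightarrow> complex) \<Rightarrow> real \<Rightarrow> ennreal" where
  "crearr f = rearr lebesgue (\<lambda>x. ennreal (norm (f x)))"

definition fourier :: "(real ^ 'n \<Rightarrow> complex) \<Rightarrow> real ^ 'n \<Rightarrow> complex" where
  "fourier f x =
     (LINT y|lebesgue. exp (- (2 * complex_of_real pi * \<i> * complex_of_real (x \<bullet> y))) * f y)"

end

theory Submission
  imports Defs "HOL-Probability.Characteristic_Functions"
begin

text \<open>
  Write \<open>S(x)\<close> for the integral of \<open>f\<^sup>*\<close> over \<open>(0, 1/x)\<close> and \<open>J(x)\<close> for \<open>1/x\<close> times the integral of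
  \<open>(f\<^sup>*)\<^sup>2\<close> over \<open>(1/x, \<infinity>)\<close>.  Everything rests on the pointwise estimate that the rearrangement of the
  Fourier transform of \<open>f\<close> at \<open>x\<close> is at most \<open>2 S(x)
      + sqrt (J(x))\<close>.  Cut \<open>f\<close> at the height
  \<open>f\<^sup>*(1/x)\<close>: the Fourier transform of the large part is bounded by its \<open>L\<^sup>1\<close> norm, hence by \<open>S(x)\<close>, and
  that of the small part is controlled by Plancherel and Chebyshev.  Since \<open>f\<^sup>*\<close> is non-increasing,
  \<open>sqrt (J(x))\<close> is also at most \<open>S(x)\<close> plus the operator of condition (1), so either condition
  combines with the Hardy inequality to give the rearranged estimate.  The weighted estimate follows by
  Hardy-Littlewood for \<open>U\<close> and its reverse for \<open>W\<close>.

  Of Plancherel only the inequality is needed.  Inserting a Gaussian weight turns the square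
  of the \<open>L\<^sup>2\<close> norm of the transform into a double integral of \<open>f(y) cnj (f(z))\<close> against a Gaussian
  in \<open>y - z\<close> of total mass 1, which \<open>2ab \<le> a\<^sup>2
      + b\<^sup>2\<close> bounds; then the weight is removed by Fatou.
\<close>

section \<open>Sigma-finiteness of Lebesgue measure, as required for Fubini\<close>

lemma sigma_finite_completion:
  assumes "sigma_finite_measure M"
  shows "sigma_finite_measure (completion M)"
proof -
  from assms obtain A where "countable A" "A \<subseteq> sets M" "\<Union>A
      = space M" "\<forall>a\<in>A. emeasure M a \<noteq> \<infinity>"
    unfolding sigma_finite_measure_def by blast
  then show ?thesis
    unfolding sigma_finite_measure_def
    by (intro exI[of _ A]) (auto simp: emeasure_completion intro: main_part_sets)
qed

lemma sigma_finite_lebesgue: "sigma_finite_measure lebesgue"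
  by (rule sigma_finite_completion) (rule sigma_finite_lborel)

subsection \<open>Powers\<close>

lemma ennpow_top [simp]: "\<infinity> ennpow r = \<infinity>" "top ennpow r = top"
  by (auto simp: ennpow_def infinity_ennreal_def)

lemma ennpow_0 [simp]: "0 ennpow r = 0"
  by (simp add: ennpow_def)

lemma ennpow_1 [simp]: "x ennpow 1 = x"
  by (cases x) (auto simp: ennpow_def)

lemma ennpow_ennreal: "0 \<le> a \<Longrightarrow> ennreal a ennpow r = ennreal (a powr r)"
  by (simp add: ennpow_def)

lemma ennpow_mono: "x \<le> y \<Longrightarrow> 0 \<le> r \<Longrightarrow> x ennpow r \<le> y ennpow r"
  by (cases x; cases y) (auto simp: ennpow_ennreal powr_mono2 top_unique)

lemma ennpow_mult: "0 < r \<Longrightarrow> (x * y) ennpow r = x ennpow r * y ennpow r"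
  by (cases x; cases y)
     (auto simp: ennpow_ennreal powr_mult ennreal_mult_top ennreal_top_mult simp flip: ennreal_mult)

lemma ennpow_ennpow: "(x ennpow r) ennpow s = x ennpow (r * s)"
  by (cases x) (auto simp: ennpow_ennreal powr_powr)

lemma ennpow_2: "x ennpow 2 = x\<^sup>2"
  by (cases x) (auto simp: ennpow_ennreal ennreal_power ennreal_power[symmetric] power2_eq_square ennreal_mult)

lemma ennpow_max: "0 \<le> r \<Longrightarrow> max x y ennpow r = max (x ennpow r) (y ennpow r)"
  using ennpow_mono[of x y r] ennpow_mono[of y x r] by (auto simp: max_def intro: antisym)

text \<open>Bounding the sum by twice the maximum, rather than by convexity, covers exponents on
  both sides of 1; this matters because \<open>q\<close> may be less than 1.\<close>

lemma ennpow_add_le: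
  assumes "0 < r"
  shows "(x + y) ennpow r \<le> ennreal (2 powr r) * (x ennpow r + y ennpow r)"
proof -
  have "x + y \<le> max x y + max x y"
    by (intro add_mono) auto
  then have "x + y \<le> ennreal 2 * max x y"
    by (simp flip: mult_2)
  then have "(x + y) ennpow r \<le> (ennreal 2 * max x y) ennpow r"
    using assms by (intro ennpow_mono) auto
  also have "\<dots> = ennreal (2 powr r) * max (x ennpow r) (y ennpow r)"
    using assms by (simp add: ennpow_mult ennpow_max ennpow_ennreal del: ennreal_numeral)
  also have "\<dots> \<le> ennreal (2 powr r) * (x ennpow r + y ennpow r)"
    by (intro mult_left_mono) (auto simp: max_def)
  finally show ?thesis .
qed

text \<open>Carries superlevel sets of a power over to superlevel sets of its base, which is how
  powers pass through distribution functions.\<close>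

lemma less_ennpow_iff:
  assumes "0 \<le> a" "0 < r"
  shows "ennreal a < x ennpow r \<longleftrightarrow> ennreal (a powr (1/r)) < x"
proof (cases x)
  case (real b)
  have "a < b powr r \<longleftrightarrow> a powr (1/r) < b"
    using assms real powr_less_mono2[of r "a powr (1/r)" b] powr_less_mono2[of "1/r" a "b powr r"]
    by (auto simp: powr_powr)
  then show ?thesis
    using assms real by (simp add: ennpow_ennreal ennreal_less_iff)
qed (auto simp: assms)

lemma borel_measurable_ennpow [measurable]:
  "(\<lambda>x. x ennpow r) \<in> borel_measurable borel"
  unfolding ennpow_def by measurable

subsection \<open>Rearrangements and the Hardy-Littlewood inequality\<close>

lemma distr_fun_antimono:
  "g \<in> borel_measurable M \<Longrightarrow> a \<le> b \<Longrightarrow> distr_fun M g b \<le> distr_fun M g a"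
  unfolding distr_fun_def
  by (intro emeasure_mono) (auto intro: le_less_trans[OF ennreal_leI])

text \<open>Right-continuity of the distribution function: the sets where \<open>g\<close> exceeds
  \<open>a + 1 / Suc n\<close> increase to the one where \<open>g\<close> exceeds \<open>a\<close>.
  The equivalence takes the place of the infimum in later arguments: superlevel sets of a
  rearrangement are initial intervals of (0, \<infinity>) whose length is the distribution
  function.\<close>

lemma less_rearr_iff:
  assumes [measurable]: "g \<in> borel_measurable M" and "0 \<le> a"
  shows "ennreal a < rearr M g t \<longleftrightarrow> ennreal t < distr_fun M g a"
proof
  assume less: "ennreal a < rearr M g t"
  obtain b where b: "ennreal a < b" "b < rearr M g t"
    using dense[OF less] by blast
  then obtain c where c: "b = ennreal c" "0 \<le> c"
    by (cases b) auto
  have "a < c" using b(1) c assms(2) by (simp add: ennreal_less_iff)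
  have "\<not> distr_fun M g c \<le> ennreal t"
  proof
    assume "distr_fun M g c \<le> ennreal t"
    then have "rearr M g t \<le> ennreal c"
      unfolding rearr_def using \<open>a < c\<close> assms(2) by (intro Inf_lower) auto
    then show False using b c by auto
  qed
  then show "ennreal t < distr_fun M g a"
    using distr_fun_antimono[OF assms(1), of a c] \<open>a < c\<close> by (auto simp: not_le intro: less_le_trans)
next
  assume less: "ennreal t < distr_fun M g a"
  let ?A = "\<lambda>n. {x \<in> space M. ennreal (a + 1 / Suc n) < g x}"
  have "\<exists>n. ennreal (a + 1 / real (Suc n)) < y" if y: "ennreal a < y" for y
  proof -
    obtain b where b: "ennreal a < b" "b < y"
      using dense[OF y] by blast
    then obtain c where c: "b = ennreal c" "0 \<le> c"
      by (cases b) auto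
    have "0 < c - a" using b(1) c assms(2) by (simp add: ennreal_less_iff)
    then obtain n where "inverse (real (Suc n)) < c - a"
      using reals_Archimedean by blast
    then have "ennreal (a + 1 / real (Suc n)) < ennreal c"
      using assms(2) \<open>0 < c - a\<close> by (intro ennreal_lessI) (auto simp: inverse_eq_divide)
    then show ?thesis using b c by (auto intro: less_trans)
  qed
  moreover have "ennreal a < y" if "ennreal (a + 1 / real (Suc n)) < y" for n y
    by (rule le_less_trans[OF _ that]) (auto intro!: ennreal_leI)
  ultimately have "{x \<in> space M. ennreal a < g x} = (\<Union>n. ?A n)"
    by auto
  moreover have "incseq ?A"
  proof (intro incseq_SucI subsetI)
    fix n x assume "x \<in> ?A n"
    moreover have "ennreal (a + 1 / Suc (Suc n)) \<le> ennreal (a + 1 / Suc n)"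
      by (intro ennreal_leI) (auto simp: field_simps)
    ultimately show "x \<in> ?A (Suc n)" by auto
  qed
  ultimately have "distr_fun M g a = (SUP n. emeasure M (?A n))"
    unfolding distr_fun_def by (subst SUP_emeasure_incseq) auto
  \<comment> \<open>Continuity from below lets the strict inequality survive at a slightly larger
    height; the gap \<open>1 / Suc n\<close> then keeps the rearrangement strictly above
    \<open>a\<close>.\<close>
  with less obtain n where n: "ennreal t < distr_fun M g (a + 1 / Suc n)"
    unfolding distr_fun_def by (auto simp: less_SUP_iff)
  have "ennreal (a + 1 / Suc n) \<le> rearr M g t"
    unfolding rearr_def
  proof (intro Inf_greatest, clarify)
    fix \<alpha> :: real assume "0 < \<alpha>" and \<alpha>: "distr_fun M g \<alpha> \<le> ennreal t"
    show "ennreal (a + 1 / Suc n) \<le> ennreal \<alpha>"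
    proof (intro ennreal_leI leI notI)
      assume "\<alpha> < a + 1 / Suc n"
      then have "distr_fun M g (a + 1 / Suc n) \<le> ennreal t"
        using distr_fun_antimono[OF assms(1), of \<alpha> "a + 1 / Suc n"] \<alpha> by auto
      then show False using n by auto
    qed
  qed
  moreover have "ennreal a < ennreal (a + 1 / Suc n)"
    using assms(2) by (intro ennreal_lessI) (auto simp: add_nonneg_pos)
  ultimately show "ennreal a < rearr M g t" by auto
qed

lemma rearr_antimono: "s \<le> t \<Longrightarrow> rearr M g t \<le> rearr M g s"
  unfolding rearr_def by (intro Inf_superset_mono) (blast intro: order_trans ennreal_leI)

lemma distr_fun_ennpow:
  "0 \<le> a \<Longrightarrow> 0 < r \<Longrightarrow> distr_fun M (\<lambda>x. g x ennpow r) a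
      = distr_fun M g (a powr (1/r))"
  by (simp add: distr_fun_def less_ennpow_iff)

text \<open>A value strictly between two distinct elements is finite, hence of the form
  \<open>ennreal a\<close>, and would separate them. Together with \<open>less_rearr_iff\<close>
  this proves identities between rearrangements.\<close>

lemma ennreal_eqI_less:
  fixes x y :: ennreal
  assumes "\<And>a. 0 \<le> a \<Longrightarrow> ennreal a < x \<longleftrightarrow> ennreal a < y"
  shows "x = y"
proof -
  have "u \<le> v" if *: "\<And>a. 0 \<le> a \<Longrightarrow> ennreal a < u
      \<Longrightarrow> ennreal a < v" for u v :: ennreal
  proof (rule dense_ge)
    fix z assume "v < z"
    show "u \<le> z"
    proof (rule ccontr)
      assume "\<not> u \<le> z"
      with \<open>v < z\<close> *[of "enn2real z"] show False
        by (cases z) (auto simp: not_le dest: less_trans)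
    qed
  qed
  from this[of x y] this[of y x] assms show ?thesis
    by (auto intro: antisym)
qed

lemma rearr_ennpow:
  assumes [measurable]: "g \<in> borel_measurable M" and "0 < r"
  shows "rearr M (\<lambda>x. g x ennpow r) t = rearr M g t ennpow r"
proof (rule ennreal_eqI_less)
  fix a :: real assume "0 \<le> a"
  then show "ennreal a < rearr M (\<lambda>x. g x ennpow r) t \<longleftrightarrow> ennreal a < rearr M g t ennpow r"
    using assms(2) by (subst less_rearr_iff) (auto simp: less_ennpow_iff less_rearr_iff distr_fun_ennpow)
qed

section \<open>Measurability of monotone functions on the half-line\<close>

text \<open>Superlevel sets of a monotone function are intervals, hence Borel. The restricted space
  fits rearrangements, which are meant for positive arguments.\<close>

lemma borel_measurable_antimono_on_lebesgue:
  fixes g :: "real \<Rightarrow> ennreal"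
  assumes "\<And>s t. 0 < s \<Longrightarrow> s \<le> t \<Longrightarrow> g t \<le> g s"
  shows "g \<in> borel_measurable (lebesgue_on {0<..})"
proof (rule borel_measurableI_greater)
  fix y
  have "is_interval {t. 0 < t \<and> y < g t}"
    unfolding is_interval_1 using assms by (auto intro: less_le_trans)
  then have "{t. 0 < t \<and> y < g t} \<in> sets lebesgue"
    by (intro sets_completionI_sets) (simp add: real_interval_borel_measurable)
  moreover have "{x \<in> space (lebesgue_on {0<..}). y < g x} = {t. 0 < t \<and> y < g t}"
    by auto
  ultimately show "{x \<in> space (lebesgue_on {0<..}). y < g x} \<in> sets (lebesgue_on {0<..})"
    by (auto simp: sets_restrict_space_iff)
qed

lemma borel_measurable_mono_on_lebesgue:
  fixes g :: "real \<Rightarrow> ennreal"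
  assumes "\<And>s t. 0 < s \<Longrightarrow> s \<le> t \<Longrightarrow> g s \<le> g t"
  shows "g \<in> borel_measurable (lebesgue_on {0<..})"
proof (rule borel_measurableI_greater)
  fix y
  have "is_interval {t. 0 < t \<and> y < g t}"
    unfolding is_interval_1
  proof (intro ballI allI impI CollectI)
    fix a b x assume "a \<in> {t. 0 < t \<and> y < g t}" "a \<le> x \<and> x \<le> b"
    then show "0 < x \<and> y < g x" using assms[of a x] by auto
  qed
  then have "{t. 0 < t \<and> y < g t} \<in> sets lebesgue"
    by (intro sets_completionI_sets) (simp add: real_interval_borel_measurable)
  moreover have "{x \<in> space (lebesgue_on {0<..}). y < g x} = {t. 0 < t \<and> y < g t}"
    by auto
  ultimately show "{x \<in> space (lebesgue_on {0<..}). y < g x} \<in> sets (lebesgue_on {0<..})"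
    by (auto simp: sets_restrict_space_iff)
qed

lemma borel_measurable_rearr [measurable]:
  "rearr M g \<in> borel_measurable (lebesgue_on {0<..})"
  by (rule borel_measurable_antimono_on_lebesgue) (rule rearr_antimono)

section \<open>The layer-cake formula and the two rearrangement inequalities\<close>

lemma emeasure_lebesgue_Ioi: "emeasure lebesgue {a::real<..} = top"
proof -
  have "of_nat n \<le> emeasure lebesgue {a<..}" for n
    using emeasure_mono[of "{a<..<a + real n}" "{a<..}" lebesgue]
    by (auto simp: ennreal_of_nat_eq_real_of_nat subset_eq)
  then have "(SUP n. of_nat n) \<le> emeasure lebesgue {a<..}"
    by (intro SUP_least)
  then show ?thesis
    by (simp add: ennreal_SUP_of_nat_eq_top top_unique)
qed

text \<open>Writes a value of [0, \<infinity>] as a length, the one-dimensional input of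
  \<open>layer_cake\<close>; it also measures the initial intervals that arise as superlevel sets of
  rearrangements.\<close>

lemma emeasure_below:
  "emeasure lebesgue {t. 0 < t \<and> ennreal t < c} = c"
proof (cases c)
  case (real r)
  then have "{t. 0 < t \<and> ennreal t < c} = {0<..<r}"
    by (auto simp: ennreal_less_iff)
  then show ?thesis using real by simp
next
  case top
  then have "{t. 0 < t \<and> ennreal t < c} = {0<..}" by auto
  then show ?thesis using top by (simp add: emeasure_lebesgue_Ioi)
qed

text \<open>The two directions of the Hardy-Littlewood inequality need the cut in \<open>G\<close> with \<open><\<close> and
  with \<open>\<le>\<close> respectively, hence the parameter \<open>P\<close>.\<close>

lemma layer_cake:
  fixes F G :: "'a \<Rightarrow> ennreal" and P :: "ennreal \<Rightarrow> ennreal \<Rightarrow> bool"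
  assumes "sigma_finite_measure M"
    and [measurable]: "F \<in> borel_measurable M" "G \<in> borel_measurable M"
    and P [measurable]: "Measurable.pred (borel \<Otimes>\<^sub>M borel) (\<lambda>(x, y). P x y)"
    and P_eq: "\<And>y. emeasure lebesgue {b. 0 < b \<and> P (ennreal b) y} = y"
  shows "(\<integral>\<^sup>+x. F x * G x \<partial>M)
      = (\<integral>\<^sup>+a. \<integral>\<^sup>+b. emeasure M {x \<in> space M. 0 < a \<and> 0 < b \<and>
            ennreal a < F x \<and> P (ennreal b) (G x)} \<partial>lborel \<partial>lborel)"
proof -
  interpret M: sigma_finite_measure M by fact
  interpret LM: pair_sigma_finite lborel M ..
  let ?i = "\<lambda>a b x. indicator {x. 0 < a \<and> 0 < b \<and> ennreal a < F x \<and> P (ennreal b) (G x)} x :: ennreal"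
  have [measurable]: "Measurable.pred (lborel \<Otimes>\<^sub>M borel) (\<lambda>(b, y). P (ennreal b) y)"
    by measurable
  have i: "(\<integral>\<^sup>+x. ?i a b x \<partial>M) = emeasure M {x \<in> space M. 0 < a \<and> 0 < b \<and>
            ennreal a < F x \<and> P (ennreal b) (G x)}" (is "_ = emeasure M ?X") for a b
  proof -
    have "(\<integral>\<^sup>+x. ?i a b x \<partial>M) = (\<integral>\<^sup>+x. indicator ?X x \<partial>M)"
      by (intro nn_integral_cong) (simp add: indicator_def)
    also have "\<dots> = emeasure M ?X"
      by (rule nn_integral_indicator) measurable
    finally show ?thesis .
  qed
  have F: "F x = (\<integral>\<^sup>+a. indicator {a. 0 < a \<and> ennreal a < F x} a \<partial>lborel)" for x
    using emeasure_below[of "F x"] by (subst nn_integral_indicator) auto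
  have G: "G x = (\<integral>\<^sup>+b. indicator {b. 0 < b \<and> P (ennreal b) (G x)} b \<partial>lborel)" for x
    using P_eq[of "G x"] by (subst nn_integral_indicator) auto
  \<comment> \<open>Both factors are lengths, so their product is the area of a rectangle of pairs
    of heights; Fubini then moves the integral over \<open>M\<close> innermost.\<close>
  have "F x * G x = (\<integral>\<^sup>+a. indicator {a. 0 < a \<and> ennreal a < F x} a * 
      (\<integral>\<^sup>+b. indicator {b. 0 < b \<and> P (ennreal b) (G x)} b \<partial>lborel) \<partial>lborel)" for x
    by (subst nn_integral_multc) (auto simp flip: F G)
  also have "(\<integral>\<^sup>+a. indicator {a. 0 < a \<and> ennreal a < F x} a * 
      (\<integral>\<^sup>+b. indicator {b. 0 < b \<and> P (ennreal b) (G x)} b \<partial>lborel) \<partial>lborel)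
     = (\<integral>\<^sup>+a. \<integral>\<^sup>+b. ?i a b x \<partial>lborel \<partial>lborel)" for x
    by (subst nn_integral_cmult[symmetric])
       (auto intro!: nn_integral_cong simp: indicator_def)
  finally have "(\<integral>\<^sup>+x. F x * G x \<partial>M)
      = (\<integral>\<^sup>+x. \<integral>\<^sup>+a. \<integral>\<^sup>+b. ?i a b x \<partial>lborel \<partial>lborel \<partial>M)"
    by simp
  also have "\<dots> = (\<integral>\<^sup>+a. \<integral>\<^sup>+x. \<integral>\<^sup>+b. ?i a b x \<partial>lborel \<partial>M \<partial>lborel)"
    by (rule LM.Fubini') measurable
  also have "\<dots> = (\<integral>\<^sup>+a. \<integral>\<^sup>+b. \<integral>\<^sup>+x. ?i a b x \<partial>M \<partial>lborel \<partial>lborel)"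
    by (intro nn_integral_cong LM.Fubini') measurable
  also have "\<dots> = (\<integral>\<^sup>+a. \<integral>\<^sup>+b. emeasure M {x \<in> space M. 0 < a \<and> 0 < b \<and>
            ennreal a < F x \<and> P (ennreal b) (G x)} \<partial>lborel \<partial>lborel)"
    by (simp only: i)
  finally show ?thesis .
qed

lemma emeasure_atMost_below:
  "emeasure lebesgue {t. 0 < t \<and> ennreal t \<le> c} = c"
proof (cases c)
  case (real r)
  then have "{t. 0 < t \<and> ennreal t \<le> c} = {0<..r}"
    by (auto simp: ennreal_le_iff)
  then show ?thesis using real by simp
next
  case top
  then have "{t. 0 < t \<and> ennreal t \<le> c} = {0<..}" by auto
  then show ?thesis using top by (simp add: emeasure_lebesgue_Ioi)
qed

lemma nn_set_integral_lebesgue_on: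
  "A \<in> sets lebesgue \<Longrightarrow> (\<integral>\<^sup>+x\<in>A. f x \<partial>lebesgue)
      = (\<integral>\<^sup>+x. f x \<partial>lebesgue_on A)"
  by (subst nn_integral_restrict_space) auto

lemma sigma_finite_lebesgue_on:
  "A \<in> sets lebesgue \<Longrightarrow> sigma_finite_measure (lebesgue_on A)"
  by (rule sigma_finite_measure_restrict_space[OF sigma_finite_lebesgue])

text \<open>By \<open>layer_cake\<close> it suffices to compare at fixed heights. The intersection
  of two superlevel sets has at most the smaller of the two measures, and the rearrangements attain
  this minimum because their superlevel sets are nested initial intervals.\<close>

lemma Hardy_Littlewood:
  assumes M: "sigma_finite_measure M"
    and F [measurable]: "F \<in> borel_measurable M" and G [measurable]: "G \<in> borel_measurable M"
  shows "(\<integral>\<^sup>+x. F x * G x \<partial>M) \<le> (\<integral>\<^sup>+t\<in>{0<..}. rearr M F t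
      * rearr M G t \<partial>lebesgue)"
proof -
  have *: "emeasure M {x \<in> space M. 0 < a \<and> 0 < b \<and> ennreal a < F x \<and> ennreal b < G x}
      \<le> emeasure (lebesgue_on {0<..}) {t \<in> space (lebesgue_on {0<..}). 0 < a \<and> 0 < b \<and>
          ennreal a < rearr M F t \<and> ennreal b < rearr M G t}" for a b
  proof (cases "0 < a \<and> 0 < b")
    case True
    have "emeasure M {x \<in> space M. 0 < a \<and> 0 < b \<and> ennreal a < F x \<and> ennreal b < G x}
        \<le> min (distr_fun M F a) (distr_fun M G b)"
      unfolding distr_fun_def by (auto intro!: emeasure_mono)
    also have "\<dots> = emeasure lebesgue {t. 0 < t \<and> ennreal t < min (distr_fun M F a) (distr_fun M G b)}"
      by (simp only: emeasure_below)
    also have "{t. 0 < t \<and> ennreal t < min (distr_fun M F a) (distr_fun M G b)} =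
       {t \<in> space (lebesgue_on {0<..}). 0 < a \<and> 0 < b \<and> ennreal a < rearr M F t \<and> ennreal b < rearr M G t}"
      using True less_rearr_iff[OF F, of a] less_rearr_iff[OF G, of b] by (auto simp del: ennreal_less_iff)
    also have "emeasure lebesgue \<dots> = emeasure (lebesgue_on {0<..}) \<dots>"
      by (rule emeasure_restrict_space[symmetric]) auto
    finally show ?thesis .
  qed auto
  have "(\<integral>\<^sup>+x. F x * G x \<partial>M)
      = (\<integral>\<^sup>+a. \<integral>\<^sup>+b. emeasure M {x \<in> space M. 0 < a \<and> 0 < b \<and>
            ennreal a < F x \<and> ennreal b < G x} \<partial>lborel \<partial>lborel)"
    by (rule layer_cake[OF M F G _ emeasure_below]) measurable
  also have "\<dots> \<le> (\<integral>\<^sup>+a. \<integral>\<^sup>+b. emeasure (lebesgue_on {0<..}) {t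
      \<in> space (lebesgue_on {0<..}).
      0 < a \<and> 0 < b \<and> ennreal a < rearr M F t \<and> ennreal b < rearr M G t} \<partial>lborel \<partial>lborel)"
    by (intro nn_integral_mono *)
  also have "\<dots> = (\<integral>\<^sup>+t. rearr M F t * rearr M G t \<partial>lebesgue_on {0<..})"
    by (rule layer_cake[OF sigma_finite_lebesgue_on _ _ _ emeasure_below, symmetric]) auto
  finally show ?thesis
    by (simp add: nn_set_integral_lebesgue_on)
qed

text \<open>Includes the values 0 and \<infinity> through the conventions for reciprocals. It turns
  the distribution function of \<open>1 / G\<close> at \<open>1/b\<close> into the measure of the
  set where \<open>G\<close> is below \<open>b\<close>.\<close>

lemma ennreal_inverse_less_one_divide_iff:
  fixes y :: ennreal
  assumes "0 < b"
  shows "ennreal (1/b) < 1 / y \<longleftrightarrow> y < ennreal b"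
proof (cases y)
  case (real r)
  show ?thesis
  proof (cases "r = 0")
    case True
    then show ?thesis using assms real by (simp add: ennreal_divide_zero)
  next
    case False
    then have "1 / y = ennreal (1 / r)"
      using real by (simp add: divide_ennreal flip: ennreal_1)
    then show ?thesis
      using False real assms by (simp add: ennreal_less_iff field_simps)
  qed
next
  case top
  then show ?thesis by (simp add: ennreal_divide_top)
qed

text \<open>Here \<open>g\<close> is the non-decreasing rearrangement of \<open>G\<close>. At fixed
  heights its superlevel set starts at the measure \<open>m\<close> of the set where
  \<open>G\<close> is below \<open>b\<close>, so it overlaps the initial interval belonging to
  \<open>F\<close> only in the excess of \<open>distr_fun M F a\<close> over \<open>m\<close>. By
  subadditivity the corresponding set in \<open>M\<close> has at least that measure.\<close>

lemma Hardy_Littlewood_reverse: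
  assumes M: "sigma_finite_measure M"
    and F [measurable]: "F \<in> borel_measurable M" and G [measurable]: "G \<in> borel_measurable M"
    and g: "\<And>t. 0 < t \<Longrightarrow> 1 / g t = rearr M (\<lambda>x. 1 / G x) t"
    and g_meas [measurable]: "g \<in> borel_measurable (lebesgue_on {0<..})"
  shows "(\<integral>\<^sup>+t\<in>{0<..}. rearr M F t * g t \<partial>lebesgue)
      \<le> (\<integral>\<^sup>+x. F x * G x \<partial>M)"
proof -
  have *: "emeasure (lebesgue_on {0<..}) {t \<in> space (lebesgue_on {0<..}). 0 < a \<and> 0 < b \<and>
          ennreal a < rearr M F t \<and> ennreal b \<le> g t}
      \<le> emeasure M {x \<in> space M. 0 < a \<and> 0 < b \<and> ennreal a < F x \<and> ennreal b \<le> G x}"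
    (is "?l \<le> ?r") for a b
  proof (cases "0 < a \<and> 0 < b")
    case True
    define m where "m = emeasure M {x \<in> space M. G x < ennreal b}"
    have m: "m = distr_fun M (\<lambda>x. 1 / G x) (1/b)"
      using True by (simp add: m_def distr_fun_def ennreal_inverse_less_one_divide_iff)
    \<comment> \<open>Negating \<open>less_rearr_iff\<close> for \<open>1 / G\<close> produces the
      non-strict cut, so the superlevel set of \<open>g\<close> starts exactly at
      \<open>m\<close>.\<close>
    have gm: "ennreal b \<le> g t \<longleftrightarrow> m \<le> ennreal t" if "0 < t" for t
      using True that less_rearr_iff[of "\<lambda>x. 1 / G x" M "1/b" t]
        ennreal_inverse_less_one_divide_iff[of b "g t"]
      by (auto simp: m g[symmetric] not_less[symmetric])
    have "{t \<in> space (lebesgue_on {0<..}). 0 < a \<and> 0 < b \<and> ennreal a < rearr M F t \<and> ennreal b \<le> g t}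
        = {t. 0 < t \<and> ennreal t < distr_fun M F a \<and> m \<le> ennreal t}"
      using True less_rearr_iff[OF F, of a] gm by auto
    then have "?l = emeasure lebesgue {t. 0 < t \<and> ennreal t < distr_fun M F a \<and> m \<le> ennreal t}"
      by (simp only:) (rule emeasure_restrict_space; auto)
    also have "\<dots> \<le> ?r"
    proof (cases "m < distr_fun M F a")
      case less: True
      \<comment> \<open>Strictness makes \<open>m\<close> finite, which permits cancelling it at the
        end of this case.\<close>
      then have "m < top" by (auto intro: less_le_trans)
      let ?A = "{t. 0 < t \<and> ennreal t < m}"
        and ?B = "{t. 0 < t \<and> ennreal t < distr_fun M F a \<and> m \<le> ennreal t}"
      have "m + emeasure lebesgue ?B = emeasure lebesgue ?A + emeasure lebesgue ?B"
        by (simp add: emeasure_below)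
      also have "\<dots> = emeasure lebesgue (?A \<union> ?B)"
        by (intro plus_emeasure) auto
      also have "?A \<union> ?B = {t. 0 < t \<and> ennreal t < distr_fun M F a}"
        using less by auto
      also have "emeasure lebesgue \<dots> = distr_fun M F a"
        by (rule emeasure_below)
      also have "\<dots> \<le> emeasure M ({x \<in> space M. G x < ennreal b} \<union>
          {x \<in> space M. 0 < a \<and> 0 < b \<and> ennreal a < F x \<and> ennreal b \<le> G x})"
        unfolding distr_fun_def using True by (intro emeasure_mono) auto
      also have "\<dots> \<le> m + ?r"
        unfolding m_def by (intro emeasure_subadditive) auto
      finally show ?thesis
        using \<open>m < top\<close> by (auto simp: ennreal_add_left_cancel_le)
    next
      case False
      then have "{t. 0 < t \<and> ennreal t < distr_fun M F a \<and> m \<le> ennreal t} = {}"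
        by auto
      then show ?thesis by (simp del: Collect_empty_eq)
    qed
    finally show ?thesis .
  qed auto
  have "(\<integral>\<^sup>+t. rearr M F t * g t \<partial>lebesgue_on {0<..}) =
      (\<integral>\<^sup>+a. \<integral>\<^sup>+b. emeasure (lebesgue_on {0<..}) {t \<in> space (lebesgue_on {0<..}).
      0 < a \<and> 0 < b \<and> ennreal a < rearr M F t \<and> ennreal b \<le> g t} \<partial>lborel \<partial>lborel)"
    by (rule layer_cake[OF sigma_finite_lebesgue_on _ _ _ emeasure_atMost_below]) auto
  also have "\<dots> \<le> (\<integral>\<^sup>+a. \<integral>\<^sup>+b. emeasure M {x
      \<in> space M. 0 < a \<and> 0 < b \<and>
            ennreal a < F x \<and> ennreal b \<le> G x} \<partial>lborel \<partial>lborel)"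
    by (intro nn_integral_mono *)
  also have "\<dots> = (\<integral>\<^sup>+x. F x * G x \<partial>M)"
    by (rule layer_cake[OF M F G _ emeasure_atMost_below, symmetric]) measurable
  finally show ?thesis
    by (simp add: nn_set_integral_lebesgue_on)
qed

subsection \<open>Gaussians and Plancherel's inequality\<close>

text \<open>Lebesgue measure is the image of a product of one-dimensional Lebesgue measures under
  the coordinate map, so the variables separate.\<close>

lemma integral_lborel_prod:
  fixes f :: "'a::euclidean_space \<Rightarrow> real \<Rightarrow> 'b::{real_normed_field, banach, second_countable_topology}"
  assumes "\<And>b. b \<in> Basis \<Longrightarrow> integrable lborel (f b)"
  shows "(LINT x|lborel. (\<Prod>b\<in>Basis. f b (x \<bullet> b))) = (\<Prod>b\<in>Basis. LINT x|lborel. f b x)"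
    and "integrable lborel (\<lambda>x. \<Prod>b\<in>Basis. f b (x \<bullet> b))"
proof -
  interpret product_sigma_finite "\<lambda>_::'a. lborel :: real measure" ..
  have [measurable]: "f b \<in> borel_measurable borel" if "b \<in> Basis" for b
    using assms[OF that] by auto
  have *: "(\<Prod>b\<in>Basis. f b ((\<Sum>b\<in>Basis. y b *\<^sub>R b) \<bullet> b))
      = (\<Prod>b\<in>Basis. f b (y b))" for y
    by (intro prod.cong) simp_all
  have m: "(\<lambda>x. \<Prod>b\<in>Basis. f b (x \<bullet> b)) \<in> borel_measurable borel"
    by measurable
  have m': "(\<lambda>y. \<Sum>b\<in>Basis. y b *\<^sub>R b)
      \<in> measurable (\<Pi>\<^sub>M b\<in>Basis. lborel) (borel :: 'a measure)"
    by measurable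
  show "(LINT x|lborel. (\<Prod>b\<in>Basis. f b (x \<bullet> b))) = (\<Prod>b\<in>Basis. LINT x|lborel. f b x)"
    by (subst lborel_eq, subst integral_distr[OF m' m]) (simp add: * product_integral_prod assms)
  show "integrable lborel (\<lambda>x. \<Prod>b\<in>Basis. f b (x \<bullet> b))"
    by (subst lborel_eq, subst integrable_distr_eq[OF m' m]) (simp add: * product_integrable_prod assms)
qed

lemma borel_measurable_lebesgue_ident [measurable]:
  "(\<lambda>x. x) \<in> borel_measurable lebesgue"
  "fst \<in> borel_measurable (lebesgue \<Otimes>\<^sub>M M)"
  "snd \<in> borel_measurable (M \<Otimes>\<^sub>M lebesgue)"
proof -
  show *: "(\<lambda>x. x) \<in> borel_measurable lebesgue"
    by (rule measurable_completion) simp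
  show "fst \<in> borel_measurable (lebesgue \<Otimes>\<^sub>M M)"
    by (rule measurable_compose[OF measurable_fst *])
  show "snd \<in> borel_measurable (M \<Otimes>\<^sub>M lebesgue)"
    by (rule measurable_compose[OF measurable_snd *])
qed

text \<open>This is the characteristic function of the standard normal law at
  \<open>- (2 * pi * v / s)\<close>, after the substitution of \<open>s * x\<close> for
  \<open>x\<close>. The factor \<open>sqrt (2 * pi)\<close> undoes the normalisation of the
  density.\<close>

lemma has_integral_exp_Gaussian:
  fixes s v :: real
  assumes "0 < s"
  shows "has_bochner_integral lborel
      (\<lambda>x. exp (- (2 * complex_of_real pi * \<i> * complex_of_real (x * v))) * complex_of_real (exp (- (s
          * x)\<^sup>2 / 2)))
      (complex_of_real (sqrt (2 * pi) / s * exp (- (2 * pi * v / s)\<^sup>2 / 2)))"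
proof -
  let ?c = "complex_of_real (sqrt (2 * pi))"
  let ?t = "- (2 * pi * v / s)"
  interpret real_distribution std_normal_distribution
    by (rule real_dist_normal_dist)
  have "integrable std_normal_distribution (\<lambda>x. iexp (?t * x))"
    by (rule integrable_iexp) auto
  then have i: "integrable lborel (\<lambda>x. std_normal_density x *\<^sub>R iexp (?t * x))"
    by (subst (asm) integrable_density) auto
  have "(LINT x|std_normal_distribution. iexp (?t * x)) = complex_of_real (exp (- (?t\<^sup>2) / 2))"
    using fun_cong[OF char_std_normal_distribution, of ?t] by (simp add: char_def)
  then have "(LINT x|lborel. std_normal_density x *\<^sub>R iexp (?t * x)) = complex_of_real (exp (- (?t\<^sup>2) / 2))"
    by (subst (asm) integral_density) auto
  with i have "has_bochner_integral lborel (\<lambda>x. std_normal_density x *\<^sub>R iexp (?t * x))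
      (complex_of_real (exp (- (?t\<^sup>2) / 2)))"
    by (simp add: has_bochner_integral_iff)
  from has_bochner_integral_mult_right[OF this, of ?c]
  have "has_bochner_integral lborel (\<lambda>x. ?c * (std_normal_density x *\<^sub>R iexp (?t * x)))
      (?c * complex_of_real (exp (- (?t\<^sup>2) / 2)))" .
  from lborel_has_bochner_integral_real_affine_iff[THEN iffD1, OF _ this, of s 0] assms
  have "has_bochner_integral lborel (\<lambda>x. ?c * (std_normal_density (s * x) *\<^sub>R iexp (?t * (s * x))))
      ((?c * complex_of_real (exp (- (?t\<^sup>2) / 2))) /\<^sub>R s)"
    by simp
  also have "(\<lambda>x. ?c * (std_normal_density (s * x) *\<^sub>R iexp (?t * (s * x))))
      = (\<lambda>x. exp (- (2 * complex_of_real pi * \<i> * complex_of_real (x * v))) * complex_of_real (exp (- (s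
      * x)\<^sup>2 / 2)))"
  proof
    fix x
    have "?c * complex_of_real (1 / sqrt (2 * pi)) = 1"
      by (simp flip: of_real_mult)
    moreover have "iexp (?t * (s * x)) = exp (- (2 * complex_of_real pi * \<i> * complex_of_real (x * v)))"
      using assms by (intro arg_cong[where f=exp]) (simp add: field_simps)
    ultimately show "?c * (std_normal_density (s * x) *\<^sub>R iexp (?t * (s * x))) =
      exp (- (2 * complex_of_real pi * \<i> * complex_of_real (x * v))) * complex_of_real (exp (- (s * x)\<^sup>2 / 2))"
      unfolding std_normal_density_def scaleR_conv_of_real of_real_mult by (simp add: mult_ac)
  qed
  also have "(?c * complex_of_real (exp (- (?t\<^sup>2) / 2))) /\<^sub>R s
      = complex_of_real (sqrt (2 * pi) / s * exp (- (2 * pi * v / s)\<^sup>2 / 2))"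
    by (simp add: scaleR_conv_of_real field_simps)
  finally show ?thesis .
qed

lemma nn_integral_Gaussian:
  assumes "0 < s"
  shows "(\<integral>\<^sup>+x. ennreal (exp (- (s * x)\<^sup>2 / 2)) \<partial>lborel) = ennreal (sqrt (2 * pi) / s)"
proof -
  have "has_bochner_integral lborel (\<lambda>x. complex_of_real (exp (- (s
      * x)\<^sup>2 / 2))) (complex_of_real (sqrt (2 * pi) / s))"
    using has_integral_exp_Gaussian[OF assms, of 0] by simp
  from has_bochner_integral_bounded_linear[OF bounded_linear_Re this]
  have "has_bochner_integral lborel (\<lambda>x. exp (- (s * x)\<^sup>2 / 2)) (sqrt (2 * pi) / s)"
    by (simp only: Re_complex_of_real)
  then show ?thesis
    using assms by (auto simp: has_bochner_integral_iff nn_integral_eq_integral)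
qed

section \<open>The Fourier kernel and Gaussians in n dimensions\<close>

definition wave :: "'a::euclidean_space \<Rightarrow> 'a \<Rightarrow> complex" where
  "wave x y = exp (- (2 * complex_of_real pi * \<i> * complex_of_real (x \<bullet> y)))"

text \<open>Equals exp of minus half the squared length of \<open>s *\<^sub>R x\<close>; the product
  form lets integrals factor over the coordinates.\<close>

definition Gauss :: "real \<Rightarrow> 'a::euclidean_space \<Rightarrow> real" where
  "Gauss s x = (\<Prod>b\<in>Basis. exp (- (s * (x \<bullet> b))\<^sup>2 / 2))"

text \<open>For positive \<open>s\<close> this is the density of independent centred normal
  coordinates with standard deviation \<open>s / (2 * pi)\<close>.\<close>

definition Gauss_transform :: "real \<Rightarrow> 'a::euclidean_space \<Rightarrow> real" where
  "Gauss_transform s v = (\<Prod>b\<in>(Basis::'a set). sqrt (2 * pi) / s * exp (- (2 * pi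
      * (v \<bullet> b) / s)\<^sup>2 / 2))"

lemma norm_wave [simp]: "norm (wave x y) = 1"
  using norm_exp_i_times[of "- (2 * pi * (x \<bullet> y))"] by (simp add: wave_def mult_ac)

lemma wave_diff: "wave x (y - z) = wave x y * cnj (wave x z)"
  by (simp add: wave_def exp_cnj inner_diff_right ring_distribs flip: exp_add)

lemma borel_measurable_cnj [measurable (raw)]:
  "f \<in> borel_measurable M \<Longrightarrow> (\<lambda>x. cnj (f x)) \<in> borel_measurable M"
  by (rule borel_measurable_continuous_on[OF continuous_on_cnj[OF continuous_on_id]])

lemma borel_measurable_wave [measurable (raw)]:
  assumes "f \<in> borel_measurable M" "g \<in> borel_measurable M"
  shows "(\<lambda>x. wave (f x) (g x)) \<in> borel_measurable M"
  unfolding wave_def using assms by measurable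

lemma borel_measurable_Gauss [measurable]: "Gauss s \<in> borel_measurable borel"
  unfolding Gauss_def[abs_def] by measurable

lemma borel_measurable_Gauss_transform [measurable]: "Gauss_transform s \<in> borel_measurable borel"
  unfolding Gauss_transform_def[abs_def] by measurable

lemma Gauss_nonneg: "0 \<le> Gauss s x"
  by (simp add: Gauss_def prod_nonneg)

lemma Gauss_transform_nonneg: "0 < s \<Longrightarrow> 0 \<le> Gauss_transform s x"
  by (simp add: Gauss_transform_def prod_nonneg)

lemma wave_Gauss_prod:
  "wave x v * Gauss s x = (\<Prod>b\<in>Basis. exp (- (2 * complex_of_real pi * \<i>
      * complex_of_real ((x \<bullet> b) * (v \<bullet> b)))) * complex_of_real (exp (- (s * (x \<bullet> b))\<^sup>2 / 2)))"
proof -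
  have "wave x v = exp (\<Sum>b\<in>Basis. - (2 * complex_of_real pi * \<i> * complex_of_real ((x \<bullet> b)
      * (v \<bullet> b))))"
    unfolding wave_def by (subst euclidean_inner) (simp add: sum_distrib_left sum_negf)
  then show ?thesis
    by (simp add: exp_sum prod.distrib Gauss_def)
qed

lemma integral_wave_Gauss:
  fixes v :: "'a::euclidean_space"
  assumes "0 < s"
  shows "(LINT x|lborel. wave x v * Gauss s x) = Gauss_transform s v"
  unfolding wave_Gauss_prod
  by (subst integral_lborel_prod)
     (use has_integral_exp_Gaussian[OF assms] in \<open>auto simp: has_bochner_integral_iff Gauss_transform_def\<close>)

lemma integrable_Gauss:
  assumes "0 < s"
  shows "integrable lborel (Gauss s :: 'a::euclidean_space \<Rightarrow> real)"
proof -
  have "integrable lborel (\<lambda>x. wave x (0::'a) * Gauss s x)"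
    unfolding wave_Gauss_prod
    by (rule integral_lborel_prod, rule integrable.intros) (rule has_integral_exp_Gaussian[OF assms])
  from integrable_bounded_linear[OF bounded_linear_Re this] show ?thesis
    by (simp add: wave_def)
qed

lemma nn_integral_Gauss_transform:
  assumes "0 < s"
  shows "(\<integral>\<^sup>+v. ennreal (Gauss_transform s (v::'a::euclidean_space)) \<partial>lborel) = 1"
proof -
  have "(\<integral>\<^sup>+v. ennreal (Gauss_transform s (v::'a)) \<partial>lborel)
      = (\<integral>\<^sup>+v. (\<Prod>b\<in>(Basis::'a set). ennreal (sqrt (2 * pi) / s * exp (- (2 * pi / s
          * (v \<bullet> b))\<^sup>2 / 2))) \<partial>lborel)"
    unfolding Gauss_transform_def using assms by (subst prod_ennreal) (auto intro!: mult_nonneg_nonneg)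
  also have "\<dots> = (\<Prod>b\<in>(Basis::'a set). \<integral>\<^sup>+x. ennreal (sqrt (2 * pi) / s * exp (- (2
      * pi / s * x)\<^sup>2 / 2)) \<partial>lborel)"
    by (rule nn_integral_lborel_prod) auto
  also have "(\<integral>\<^sup>+x. ennreal (sqrt (2 * pi) / s * exp (- (2 * pi / s * x)\<^sup>2 / 2)) \<partial>lborel) = 1"
  proof -
    have "(\<integral>\<^sup>+x. ennreal (sqrt (2 * pi) / s * exp (- (2 * pi / s * x)\<^sup>2 / 2)) \<partial>lborel)
      = ennreal (sqrt (2 * pi) / s) * (\<integral>\<^sup>+x. ennreal (exp (- (2 * pi / s
          * x)\<^sup>2 / 2)) \<partial>lborel)"
      using assms by (subst ennreal_mult) (auto simp: nn_integral_cmult)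
    also have "\<dots> = ennreal (sqrt (2 * pi) / s * (sqrt (2 * pi) / (2 * pi / s)))"
      using assms by (subst nn_integral_Gaussian) (auto simp flip: ennreal_mult)
    also have "sqrt (2 * pi) / s * (sqrt (2 * pi) / (2 * pi / s)) = 1"
      using assms by (simp add: field_simps)
    finally show ?thesis by simp
  qed
  finally show ?thesis by simp
qed

text \<open>Evenness and translation invariance give the kernel in \<open>y - z\<close> unit mass in
  either variable, so each of the two squares in the energy estimate can integrate out its free
  variable.\<close>

lemma nn_integral_Gauss_transform_diff:
  assumes "0 < s"
  shows "(\<integral>\<^sup>+z. ennreal (Gauss_transform s (y - z)) \<partial>lborel) = 1"
    and "(\<integral>\<^sup>+z. ennreal (Gauss_transform s (z - y)) \<partial>lborel) = 1"
proof -
  have *: "Gauss_transform s (y - z) = Gauss_transform s (z - y)" for z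
    using power2_commute[of "y \<bullet> b" "z \<bullet> b" for b]
    by (simp add: Gauss_transform_def inner_diff_left power_divide power_mult_distrib)
  have "(\<integral>\<^sup>+z. ennreal (Gauss_transform s z) \<partial>distr lborel borel ((+) (- y))) = 1"
    unfolding lborel_distr_plus by (rule nn_integral_Gauss_transform) fact
  then show "(\<integral>\<^sup>+z. ennreal (Gauss_transform s (z - y)) \<partial>lborel) = 1"
    by (subst (asm) nn_integral_distr) auto
  then show "(\<integral>\<^sup>+z. ennreal (Gauss_transform s (y - z)) \<partial>lborel) = 1"
    by (simp add: *)
qed

text \<open>Supplies the majorant for both interchanges of integrals in
  \<open>fourier_Gauss_weight_le\<close>; the factors there are the weight and the modulus of
  \<open>f\<close>.\<close>

lemma (in pair_sigma_finite) integrable_mult_pair: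
  fixes f :: "'a \<Rightarrow> real" and g :: "'b \<Rightarrow> real"
  assumes f: "integrable M1 f" and g: "integrable M2 g"
  shows "integrable (M1 \<Otimes>\<^sub>M M2) (\<lambda>(x, y). f x * g y)"
proof (rule Fubini_integrable)
  have [measurable]: "f \<in> borel_measurable M1" "g \<in> borel_measurable M2"
    using f g by auto
  show "(\<lambda>(x, y). f x * g y) \<in> borel_measurable (M1 \<Otimes>\<^sub>M M2)"
    by measurable
  show "integrable M1 (\<lambda>x. LINT y|M2. norm (case (x, y) of (x, y) \<Rightarrow> f x * g y))"
    using f by (simp add: abs_mult)
  show "AE x in M1. integrable M2 (\<lambda>y. case (x, y) of (x, y) \<Rightarrow> f x * g y)"
    using g by simp
qed

section \<open>The Fourier transform of an integrable function and its energy\<close>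

lemma fourier_wave: "fourier f x = (LINT y|lebesgue. wave x y * f y)"
  by (simp add: fourier_def wave_def)

lemma integrable_wave:
  assumes "integrable lebesgue f"
  shows "integrable lebesgue (\<lambda>y. wave x y * f y)"
proof (rule Bochner_Integration.integrable_bound[OF assms])
  have [measurable]: "f \<in> borel_measurable lebesgue" using assms by auto
  show "(\<lambda>y. wave x y * f y) \<in> borel_measurable lebesgue"
    by measurable
qed (simp add: norm_mult)

lemma norm_fourier_le:
  assumes "integrable lebesgue f"
  shows "norm (fourier f x) \<le> (LINT y|lebesgue. norm (f y))"
proof -
  have "norm (fourier f x) \<le> (LINT y|lebesgue. norm (wave x y * f y))"
    unfolding fourier_wave by (rule integral_norm_bound)
  then show ?thesis by (simp add: norm_mult)
qed

lemma borel_measurable_fourier: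
  assumes "integrable lebesgue f"
  shows "fourier f \<in> borel_measurable lebesgue"
proof -
  interpret sigma_finite_measure "lebesgue :: (real^'n) measure"
    by (rule sigma_finite_lebesgue)
  have [measurable]: "f \<in> borel_measurable lebesgue" using assms by auto
  show ?thesis
    unfolding fourier_wave[abs_def] by measurable
qed

text \<open>The transform is at first only known to be bounded, and the weight makes the double
  integrals absolutely convergent. The resulting bound does not depend on \<open>s\<close>.\<close>

lemma fourier_Gauss_weight_le:
  fixes f :: "real ^ 'n \<Rightarrow> complex"
  assumes s: "0 < s" and f: "integrable lebesgue f"
  shows "(\<integral>\<^sup>+x. ennreal (Gauss s x * (norm (fourier f x))\<^sup>2) \<partial>lebesgue)
      \<le> (\<integral>\<^sup>+y. ennreal ((norm (f y))\<^sup>2) \<partial>lebesgue)"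
proof -
  let ?L = "lebesgue :: (real^'n) measure"
  let ?K = "Gauss s :: real^'n \<Rightarrow> real"
  let ?G = "Gauss_transform s :: real^'n \<Rightarrow> real"
  let ?F = "fourier f"
  interpret sigma_finite_measure ?L by (rule sigma_finite_lebesgue)
  interpret P: pair_sigma_finite ?L ?L ..
  have [measurable]: "f \<in> borel_measurable ?L" using f by auto
  have [measurable]: "?F \<in> borel_measurable ?L" using f by (rule borel_measurable_fourier)
  have K: "integrable ?L ?K"
    using integrable_Gauss[OF s] by (simp add: integrable_completion)
  define N where "N = (LINT y|?L. norm (f y))"
  have N: "norm (?F x) \<le> N" for x
    unfolding N_def by (rule norm_fourier_le[OF f])
  have "0 \<le> N" by (simp add: N_def)
  have Kf: "integrable (?L \<Otimes>\<^sub>M ?L) (\<lambda>(x, y). ?K x * norm (f y))"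
    using K f by (intro P.integrable_mult_pair) auto
  have G: "(LINT x|?L. wave x v * ?K x) = ?G v" for v
    using integral_wave_Gauss[OF s, of v] by (subst integral_completion) auto

  \<comment> \<open>Expanding the transform inside \<open>H\<close> and interchanging integrals
    turns the weight into its own transform, so \<open>H\<close> is the conjugate of
    \<open>f\<close> convolved with \<open>Gauss_transform s\<close>.\<close>
  define H where "H y = (LINT x|?L. ?K x * wave x y * cnj (?F x))" for y
  have H: "H y = (LINT z|?L. cnj (f z) * ?G (y - z))" for y
  proof -
    have "H y = (LINT x|?L. LINT z|?L. ?K x * wave x y * cnj (wave x z * f z))"
      unfolding H_def fourier_wave
      by (simp only: Bochner_Integration.integral_cnj[symmetric] integral_mult_right_zero)
    also have "\<dots> = (LINT z|?L. LINT x|?L. ?K x * wave x y * cnj (wave x z * f z))"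
    proof (rule P.Fubini_integral[symmetric], rule Bochner_Integration.integrable_bound[OF Kf])
      show "(\<lambda>(x, z). ?K x * wave x y * cnj (wave x z * f z)) \<in> borel_measurable (?L \<Otimes>\<^sub>M ?L)"
        by measurable
    qed (auto simp: norm_mult Gauss_nonneg)
    also have "\<dots> = (LINT z|?L. LINT x|?L. cnj (f z) * (wave x (y - z) * ?K x))"
      by (simp add: wave_diff mult_ac)
    also have "\<dots> = (LINT z|?L. cnj (f z) * ?G (y - z))"
      by (simp add: G)
    finally show ?thesis .
  qed

  define T where "T = (LINT x|?L. ?K x * (norm (?F x))\<^sup>2)"
  \<comment> \<open>The squared modulus is the transform times its conjugate. Expanding only the
    first factor pairs \<open>f\<close> with \<open>H\<close>; the second is bounded by
    \<open>N\<close> in the majorant.\<close>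
  have "complex_of_real T = (LINT x|?L. complex_of_real (?K x * (norm (?F x))\<^sup>2))"
    unfolding T_def by (rule integral_complex_of_real[symmetric])
  also have "\<dots> = (LINT x|?L. LINT y|?L. ?K x * (wave x y * f y) * cnj (?F x))"
  proof (rule Bochner_Integration.integral_cong[OF refl])
    fix x
    have "complex_of_real (?K x * (norm (?F x))\<^sup>2) = ?K x * ?F x * cnj (?F x)"
      by (simp only: of_real_mult complex_norm_square mult.assoc)
    also have "\<dots> = (LINT y|?L. ?K x * (wave x y * f y) * cnj (?F x))"
      by (subst (1) fourier_wave) simp
    finally show "complex_of_real (?K x * (norm (?F x))\<^sup>2) = \<dots>" .
  qed
  also have "\<dots> = (LINT y|?L. LINT x|?L. ?K x * (wave x y * f y) * cnj (?F x))"
  proof (rule P.Fubini_integral[symmetric], rule Bochner_Integration.integrable_bound)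
    show "integrable (?L \<Otimes>\<^sub>M ?L) (\<lambda>p. N * (case p of (x, y) \<Rightarrow> ?K x * norm (f y)))"
      using Kf by (rule integrable_mult_right)
    show "AE p in ?L \<Otimes>\<^sub>M ?L. norm (case p of (x, y) \<Rightarrow> ?K x * (wave x y * f y) * cnj (?F x))
        \<le> norm (N * (case p of (x, y) \<Rightarrow> ?K x * norm (f y)))"
    proof (rule AE_I2, clarify)
      fix x y
      have "Gauss s x * norm (f y) * norm (?F x) \<le> Gauss s x * norm (f y) * N"
        by (intro mult_left_mono N mult_nonneg_nonneg Gauss_nonneg) simp
      then show "norm (?K x * (wave x y * f y) * cnj (?F x)) \<le> norm (N * (?K x * norm (f y)))"
        using \<open>0 \<le> N\<close> by (simp add: norm_mult Gauss_nonneg abs_mult mult_ac)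
    qed
  qed measurable
  also have "\<dots> = (LINT y|?L. f y * H y)"
    by (simp add: H_def mult_ac flip: integral_mult_right_zero)
  finally have TH: "complex_of_real T = (LINT y|?L. f y * H y)" .

  \<comment> \<open>For a non-integrable \<open>g\<close> the integral on the left is 0 by
    convention, so the bound covers that case as well.\<close>
  have norm_le: "ennreal (norm (LINT y|?L. g y)) \<le> (\<integral>\<^sup>+y. ennreal (norm (g y)) \<partial>?L)"
    for g :: "real^'n \<Rightarrow> complex"
    by (cases "integrable ?L g") (auto intro: integral_norm_bound_ennreal simp: not_integrable_integral_eq)

  let ?g = "\<lambda>y z. ennreal (?G (y - z))"
  have g1: "(\<integral>\<^sup>+z. ?g y z \<partial>?L) = 1" and g2: "(\<integral>\<^sup>+y. ?g y z \<partial>?L)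
      = 1" for y z
    using nn_integral_Gauss_transform_diff[OF s] by (auto simp: nn_integral_completion)
  let ?R = "\<integral>\<^sup>+y. ennreal ((norm (f y))\<^sup>2) \<partial>?L"
  have "ennreal T \<le> (\<integral>\<^sup>+y. ennreal (norm (f y * H y)) \<partial>?L)"
    using norm_le[of "\<lambda>y. f y * H y"] unfolding TH[symmetric]
    by (auto intro: order_trans[rotated] ennreal_leI)
  also have "\<dots> \<le> (\<integral>\<^sup>+y. \<integral>\<^sup>+z. ennreal (norm (f y))
      * (ennreal (norm (f z)) * ?g y z) \<partial>?L \<partial>?L)"
  proof (rule nn_integral_mono)
    fix y
    have "ennreal (norm (f y * H y)) = ennreal (norm (f y)) * ennreal (norm (H y))"
      by (simp add: norm_mult ennreal_mult)
    also have "ennreal (norm (H y)) \<le> (\<integral>\<^sup>+z. ennreal (norm (f z)) * ?g y z \<partial>?L)"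
      using norm_le[of "\<lambda>z. cnj (f z) * ?G (y - z)"]
      by (simp add: H norm_mult ennreal_mult abs_of_nonneg[OF Gauss_transform_nonneg[OF s]] Gauss_transform_nonneg[OF s])
    also have "ennreal (norm (f y)) * \<dots> = (\<integral>\<^sup>+z. ennreal (norm (f y)) * (ennreal (norm (f z))
        * ?g y z) \<partial>?L)"
      by (subst nn_integral_cmult) auto
    finally show "ennreal (norm (f y * H y)) \<le> \<dots>"
      by (auto simp: mult_left_mono)
  qed
  finally have "2 * ennreal T \<le> 2 * (\<integral>\<^sup>+y. \<integral>\<^sup>+z. ennreal (norm (f y))
      * (ennreal (norm (f z)) * ?g y z) \<partial>?L \<partial>?L)"
    by (rule mult_left_mono) simp
  also have "\<dots> = (\<integral>\<^sup>+y. \<integral>\<^sup>+z. 2 * (ennreal (norm (f y))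
      * (ennreal (norm (f z)) * ?g y z)) \<partial>?L \<partial>?L)"
    by (simp add: nn_integral_cmult)
  also have "\<dots> \<le> (\<integral>\<^sup>+y. \<integral>\<^sup>+z. ennreal ((norm (f y))\<^sup>2) * ?g y z
      + ennreal ((norm (f z))\<^sup>2) * ?g y z \<partial>?L \<partial>?L)"
  proof (intro nn_integral_mono)
    fix y z
    \<comment> \<open>The doubling above prepared this elementary inequality, which decouples
      \<open>y\<close> from \<open>z\<close>.\<close>
    have "2 * (norm (f y) * norm (f z)) \<le> (norm (f y))\<^sup>2 + (norm (f z))\<^sup>2"
      using sum_squares_bound[of "norm (f y)" "norm (f z)"] by (simp add: mult_ac)
    then have "2 * (norm (f y) * (norm (f z) * ?G (y - z))) \<le> (norm (f y))\<^sup>2 * ?G (y - z)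
        + (norm (f z))\<^sup>2 * ?G (y - z)"
      using mult_right_mono[OF _ Gauss_transform_nonneg[OF s], of "2 * (norm (f y)
          * norm (f z))" "(norm (f y))\<^sup>2 + (norm (f z))\<^sup>2" "y - z"]
      by (simp add: algebra_simps)
    then have "ennreal (2 * (norm (f y) * (norm (f z) * ?G (y - z))))
        \<le> ennreal ((norm (f y))\<^sup>2 * ?G (y - z) + (norm (f z))\<^sup>2 * ?G (y - z))"
      by (rule ennreal_leI)
    then show "2 * (ennreal (norm (f y)) * (ennreal (norm (f z)) * ?g y z)) \<le>
        ennreal ((norm (f y))\<^sup>2) * ?g y z + ennreal ((norm (f z))\<^sup>2) * ?g y z"
      by (simp add: ennreal_mult ennreal_plus Gauss_transform_nonneg[OF s])
  qed
  also have "\<dots> = (\<integral>\<^sup>+y. \<integral>\<^sup>+z. ennreal ((norm (f y))\<^sup>2)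
      * ?g y z \<partial>?L \<partial>?L)
      + (\<integral>\<^sup>+y. \<integral>\<^sup>+z. ennreal ((norm (f z))\<^sup>2) * ?g y z \<partial>?L \<partial>?L)"
    by (simp add: nn_integral_add)
  also have "(\<integral>\<^sup>+y. \<integral>\<^sup>+z. ennreal ((norm (f y))\<^sup>2)
      * ?g y z \<partial>?L \<partial>?L) = ?R"
    by (simp add: nn_integral_cmult g1)
  also have "(\<integral>\<^sup>+y. \<integral>\<^sup>+z. ennreal ((norm (f z))\<^sup>2) * ?g y z \<partial>?L \<partial>?L)
      = (\<integral>\<^sup>+z. \<integral>\<^sup>+y. ennreal ((norm (f z))\<^sup>2) * ?g y z \<partial>?L \<partial>?L)"
    by (rule P.Fubini') measurable
  also have "\<dots> = ?R"
    by (simp add: nn_integral_cmult g2)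
  finally have "2 * ennreal T \<le> 2 * ?R"
    by (simp add: mult_2)
  then have "ennreal T \<le> ?R"
    by (subst (asm) ennreal_mult_le_mult_iff) auto
  \<comment> \<open>Integrability ties \<open>T\<close>, a Bochner integral with default value 0, to
    the nonnegative integral of the claim.\<close>
  moreover have "integrable ?L (\<lambda>x. ?K x * (norm (?F x))\<^sup>2)"
  proof (rule Bochner_Integration.integrable_bound)
    show "integrable ?L (\<lambda>x. N\<^sup>2 * ?K x)" using K by simp
    show "AE x in ?L. norm (?K x * (norm (?F x))\<^sup>2) \<le> norm (N\<^sup>2 * ?K x)"
      using N by (auto simp: Gauss_nonneg mult.commute[of "N\<^sup>2"] intro!: AE_I2 mult_left_mono power_mono)
  qed measurable
  ultimately show ?thesis
    unfolding T_def by (subst nn_integral_eq_integral) (auto simp: Gauss_nonneg)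
qed

lemma Plancherel_le:
  fixes f :: "real ^ 'n \<Rightarrow> complex"
  assumes f: "integrable lebesgue f"
  shows "(\<integral>\<^sup>+x. ennreal ((norm (fourier f x))\<^sup>2) \<partial>lebesgue)
      \<le> (\<integral>\<^sup>+y. ennreal ((norm (f y))\<^sup>2) \<partial>lebesgue)"
proof -
  have [measurable]: "fourier f \<in> borel_measurable lebesgue" using f by (rule borel_measurable_fourier)
  let ?K = "\<lambda>n x. ennreal (Gauss (1 / Suc n) x * (norm (fourier f x))\<^sup>2)"
  have "ennreal ((norm (fourier f x))\<^sup>2) = liminf (\<lambda>n. ?K n x)" for x
  proof -
    \<comment> \<open>With 0 in place of \<open>s\<close> every factor is exp 0, so the weights tend
      to 1 at each point.\<close>
    have "(\<lambda>n. Gauss (1 / real (Suc n)) x) \<longlonglongrightarrow> (\<Prod>b\<in>(Basis :: (real^'n) set). exp (- (0 * (x \<bullet> b))\<^sup>2 / 2))"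
      unfolding Gauss_def by (intro tendsto_intros LIMSEQ_Suc[OF lim_1_over_n]) simp
    then have "(\<lambda>n. ?K n x) \<longlonglongrightarrow> ennreal (1 * (norm (fourier f x))\<^sup>2)"
      by (intro tendsto_intros) simp
    then show ?thesis
      by (simp add: lim_imp_Liminf)
  qed
  then have "(\<integral>\<^sup>+x. ennreal ((norm (fourier f x))\<^sup>2) \<partial>lebesgue)
      = (\<integral>\<^sup>+x. liminf (\<lambda>n. ?K n x) \<partial>lebesgue)"
    by simp
  also have "\<dots> \<le> liminf (\<lambda>n. \<integral>\<^sup>+x. ?K n x \<partial>lebesgue)"
    by (rule nn_integral_liminf) measurable
  also have "\<dots> \<le> limsup (\<lambda>n. \<integral>\<^sup>+x. ?K n x \<partial>lebesgue)"
    by (rule Liminf_le_Limsup) simp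
  also have "\<dots> \<le> (\<integral>\<^sup>+y. ennreal ((norm (f y))\<^sup>2) \<partial>lebesgue)"
    by (intro Limsup_bounded always_eventually allI fourier_Gauss_weight_le f) simp
  finally show ?thesis .
qed

subsection \<open>Pointwise bound for the rearranged Fourier transform\<close>

lemma rearr_mono:
  assumes "\<And>x. x \<in> space M \<Longrightarrow> g x \<le> h x" and [measurable]: "h \<in> borel_measurable M"
  shows "rearr M g t \<le> rearr M h t"
proof -
  have "distr_fun M g \<alpha> \<le> distr_fun M h \<alpha>" for \<alpha>
    unfolding distr_fun_def using assms(1) by (intro emeasure_mono) (auto intro: less_le_trans)
  then show ?thesis
    unfolding rearr_def
    by (intro Inf_superset_mono Collect_mono impI) (elim exE conjE, rule exI, auto intro: order_trans)
qed

lemma rearr_le: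
  assumes "g \<in> borel_measurable M" "\<And>x. x \<in> space M \<Longrightarrow> g x \<le> ennreal a" "0 \<le> a" 
  shows "rearr M g t \<le> ennreal a"
proof (rule ccontr)
  assume "\<not> rearr M g t \<le> ennreal a"
  then have "ennreal t < distr_fun M g a"
    using less_rearr_iff[OF assms(1,3), of t] by (simp add: not_le)
  also have "distr_fun M g a = 0"
  proof -
    have "{x \<in> space M. ennreal a < g x} = {}"
      using assms(2) by (blast dest: leD)
    then show ?thesis by (simp only: distr_fun_def emeasure_empty)
  qed
  finally show False by simp
qed

text \<open>Chebyshev's inequality: \<open>g\<close> exceeds \<open>a\<close> on the superlevel
  set.\<close>

lemma distr_fun_mult_le:
  assumes [measurable]: "g \<in> borel_measurable M"
  shows "ennreal a * distr_fun M g a \<le> (\<integral>\<^sup>+x. g x \<partial>M)"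
proof -
  have "ennreal a * distr_fun M g a = (\<integral>\<^sup>+x. ennreal a * indicator {x
      \<in> space M. ennreal a < g x} x \<partial>M)"
    unfolding distr_fun_def by (subst nn_integral_cmult_indicator) auto
  also have "\<dots> \<le> (\<integral>\<^sup>+x. g x \<partial>M)"
    by (intro nn_integral_mono) (auto split: split_indicator)
  finally show ?thesis .
qed

lemma rearr_less_top:
  assumes [measurable]: "g \<in> borel_measurable M" and fin: "(\<integral>\<^sup>+x. g x \<partial>M) < top" and t: "0 < t"
  shows "rearr M g t < top"
proof -
  obtain N where N: "(\<integral>\<^sup>+x. g x \<partial>M) = ennreal N" "0 \<le> N"
    using fin by (cases "\<integral>\<^sup>+x. g x \<partial>M") auto
  \<comment> \<open>Chosen so that \<open>?a * t\<close> is \<open>N + 1\<close>, which exceeds the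
    integral and contradicts Chebyshev.\<close>
  let ?a = "(N + 1) / t"
  have "\<not> ennreal ?a < rearr M g t"
  proof
    assume "ennreal ?a < rearr M g t"
    then have "ennreal t \<le> distr_fun M g ?a"
      using N t by (subst (asm) less_rearr_iff) auto
    then have "ennreal ?a * ennreal t \<le> ennreal ?a * distr_fun M g ?a"
      by (rule mult_left_mono) simp
    also have "\<dots> \<le> ennreal N"
      using distr_fun_mult_le[of g M ?a] N by simp
    finally show False
      using N t by (simp flip: ennreal_mult)
  qed
  then show ?thesis
    by (auto simp: not_less intro: le_less_trans)
qed

text \<open>The rearrangement of an indicator is at most 1 and vanishes from \<open>a\<close> on.
  With \<open>Hardy_Littlewood\<close> this bounds the integral of a function over a set of measure
  at most \<open>a\<close> by that of its rearrangement over (0, a).\<close>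

lemma nn_integral_mult_rearr_indicator_le:
  assumes A: "A \<in> sets M" "emeasure M A \<le> ennreal a"
  shows "(\<integral>\<^sup>+t\<in>{0<..}. G t * rearr M (indicator A) t \<partial>lebesgue)
      \<le> (\<integral>\<^sup>+t\<in>{0<..<a}. G t \<partial>lebesgue)"
proof (intro nn_integral_mono)
  fix t
  have [measurable]: "indicator A \<in> borel_measurable M" using A by auto
  have "rearr M (indicator A) t \<le> ennreal 1"
    by (rule rearr_le) (auto split: split_indicator)
  moreover have "rearr M (indicator A) t = 0" if "a \<le> t"
  proof (rule ccontr)
    assume "rearr M (indicator A) t \<noteq> 0"
    then have "ennreal 0 < rearr M (indicator A) t"
      by (simp add: zero_less_iff_neq_zero)
    then have "ennreal t < distr_fun M (indicator A) 0"
      by (subst (asm) less_rearr_iff) auto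
    also have "distr_fun M (indicator A) 0 = emeasure M A"
      unfolding distr_fun_def using sets.sets_into_space[OF A(1)]
      by (intro arg_cong[where f="emeasure M"]) (auto split: split_indicator)
    finally show False using A that by (auto dest: ennreal_leI)
  qed
  ultimately show "G t * rearr M (indicator A) t * indicator {0<..} t \<le> G t * indicator {0<..<a} t"
    using mult_left_mono[of "rearr M (indicator A) t" 1 "G t"]
    by (cases "t < a") (auto split: split_indicator)
qed

text \<open>Squaring the right side gives the sum under the root plus nonnegative cross
  terms.\<close>

lemma ennpow_half_add_le:
  fixes x y :: ennreal
  shows "(x\<^sup>2 + y) ennpow (1/2) \<le> x + y ennpow (1/2)"
proof -
  have "y = (y ennpow (1/2))\<^sup>2"
    by (simp add: ennpow_ennpow flip: ennpow_2)
  then have "x\<^sup>2 + y \<le> (x + y ennpow (1/2))\<^sup>2"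
    by (subst \<open>y = _\<close>) (simp add: power2_eq_square ring_distribs add_increasing2 add.assoc add_left_mono)
  then have "(x\<^sup>2 + y) ennpow (1/2) \<le> ((x + y ennpow (1/2)) ennpow 2) ennpow (1/2)"
    by (intro ennpow_mono) (auto simp: ennpow_2)
  then show ?thesis
    by (simp add: ennpow_ennpow)
qed

text \<open>With \<open>a\<close> and \<open>b\<close> the two terms of the bound, the transform of
  \<open>f1\<close> never exceeds \<open>a\<close>. So where that of \<open>f\<close> exceeds
  \<open>a + b\<close>, that of \<open>f2\<close> exceeds \<open>b\<close>, and Plancherel with
  Chebyshev allows this only on a set of measure at most \<open>x\<close>.\<close>

lemma crearr_fourier_weak_type:
  fixes f :: "real ^ 'n \<Rightarrow> complex"
  assumes f: "integrable lebesgue f" and f1: "integrable lebesgue f1" and f2: "integrable lebesgue f2"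
    and split: "\<And>y. f y = f1 y + f2 y" and x: "0 < x"
  shows "crearr (fourier f) x \<le> (\<integral>\<^sup>+y. ennreal (norm (f1 y)) \<partial>lebesgue)
      + (ennreal (1/x) * (\<integral>\<^sup>+y. ennreal ((norm (f2 y))\<^sup>2) \<partial>lebesgue)) ennpow (1/2)"
    (is "_ \<le> ?A + ?B")
proof (rule ccontr)
  assume less: "\<not> crearr (fourier f) x \<le> ?A + ?B"
  note [measurable] = borel_measurable_fourier[OF f] borel_measurable_fourier[OF f2]
  let ?V = "\<integral>\<^sup>+y. ennreal ((norm (f2 y))\<^sup>2) \<partial>lebesgue"
  have "?A + ?B < top"
    using less by (meson not_le less_le_trans top_greatest)
  then obtain b where b: "?B = ennreal b" "0 \<le> b"
    by (cases ?B) auto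
  define a where "a = (LINT y|lebesgue. norm (f1 y))"
  have a: "?A = ennreal a" "0 \<le> a"
    using f1 by (auto simp: a_def nn_integral_eq_integral)
  \<comment> \<open>The height \<open>b\<close> is the one at which Chebyshev yields exactly the
    measure \<open>x\<close>: the energy of \<open>f2\<close> is \<open>x\<close> times the square
    of \<open>b\<close>.\<close>
  have "ennreal (1/x) * ?V = ?B ennpow 2"
    by (simp add: ennpow_ennpow)
  also have "\<dots> = ennreal (b\<^sup>2)"
    using b by (simp add: ennpow_2 ennreal_power)
  finally have bV: "ennreal (1/x) * ?V = ennreal (b\<^sup>2)" .
  have V: "?V = ennreal (x * b\<^sup>2)"
  proof -
    have "?V = ennreal x * (ennreal (1/x) * ?V)"
      using x by (simp add: mult.assoc[symmetric] flip: ennreal_mult)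
    then show ?thesis using bV x by (simp flip: ennreal_mult)
  qed
  have fourier_split: "fourier f y = fourier f1 y + fourier f2 y" for y
    using integrable_wave[OF f1] integrable_wave[OF f2]
    by (simp add: fourier_wave split ring_distribs)
  let ?E = "emeasure lebesgue {y. b < norm (fourier f2 y)}"
  have E_sets: "{y. b < norm (fourier f2 y)} \<in> sets lebesgue"
    using measurable_sets[of "\<lambda>y. norm (fourier f2 y)" lebesgue borel "{b<..}"] by (simp add: vimage_def)
  have "ennreal (a + b) < crearr (fourier f) x"
    using less a b by (simp add: not_le)
  then have "ennreal x < distr_fun lebesgue (\<lambda>y. ennreal (norm (fourier f y))) (a + b)"
    unfolding crearr_def using a b by (subst (asm) less_rearr_iff) auto
  also have "\<dots> \<le> ?E"
    unfolding distr_fun_def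
  proof (rule emeasure_mono)
    show "{y \<in> space lebesgue. ennreal (a + b) < ennreal (norm (fourier f y))} \<subseteq> {y. b < norm (fourier f2 y)}"
    proof safe
      fix y assume "ennreal (a + b) < ennreal (norm (fourier f y))"
      then have "a + b < norm (fourier f y)"
        using a b by (simp add: ennreal_less_iff del: ennreal_plus)
      also have "\<dots> \<le> norm (fourier f1 y) + norm (fourier f2 y)"
        unfolding fourier_split by (rule norm_triangle_ineq)
      also have "\<dots> \<le> a + norm (fourier f2 y)"
        unfolding a_def using norm_fourier_le[OF f1] by simp
      finally show "b < norm (fourier f2 y)" by simp
    qed
    show "{y. b < norm (fourier f2 y)} \<in> sets lebesgue"
      by (rule E_sets)
  qed
  finally have E: "ennreal x < ?E" .
  have Pl: "(\<integral>\<^sup>+y. ennreal ((norm (fourier f2 y))\<^sup>2) \<partial>lebesgue) \<le> ennreal (x * b\<^sup>2)"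
    using Plancherel_le[OF f2] V by simp
  show False
  proof (cases "b = 0")
    \<comment> \<open>Chebyshev says nothing at height 0; instead zero energy forces the transform
      of \<open>f2\<close> to vanish almost everywhere.\<close>
    case True
    with Pl have "(\<integral>\<^sup>+y. ennreal ((norm (fourier f2 y))\<^sup>2) \<partial>lebesgue) = 0" by simp
    then have "AE y in lebesgue. ennreal ((norm (fourier f2 y))\<^sup>2) = 0"
      by (subst (asm) nn_integral_0_iff_AE) auto
    then have "AE y in lebesgue. \<not> b < norm (fourier f2 y)"
      using True by (auto simp: power2_eq_square)
    then have "?E = 0"
      using E_sets by (subst (asm) AE_iff_measurable[OF _ refl]) auto
    then show False using E by simp
  next
    case False
    have "ennreal (b\<^sup>2) * ennreal x < ennreal (b\<^sup>2) * ?E"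
      using E False by (intro ennreal_mult_strict_left_mono) auto
    also have "\<dots> = ennreal (b\<^sup>2)
        * distr_fun lebesgue (\<lambda>y. ennreal ((norm (fourier f2 y))\<^sup>2)) (b\<^sup>2)"
    proof -
      have "b\<^sup>2 < c\<^sup>2 \<longleftrightarrow> b < c" if "0 \<le> c" for c
        using b that power_mono_iff[of c b 2] by (simp flip: not_le)
      then have "{y \<in> space lebesgue. ennreal (b\<^sup>2) < ennreal ((norm (fourier f2 y))\<^sup>2)}
          = {y. b < norm (fourier f2 y)}"
        by (simp add: ennreal_less_iff)
      then show ?thesis
        by (simp only: distr_fun_def)
    qed
    also have "\<dots> \<le> (\<integral>\<^sup>+y. ennreal ((norm (fourier f2 y))\<^sup>2) \<partial>lebesgue)"
      by (rule distr_fun_mult_le) measurable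
    finally show False
      using Pl x by (simp add: mult.commute flip: ennreal_mult)
  qed
qed

lemma crearr_less_top:
  assumes "integrable lebesgue f" "0 < t"
  shows "crearr f t < top"
  unfolding crearr_def using assms
  by (intro rearr_less_top) (auto simp: integrable_iff_bounded)

lemma crearr_antimono: "s \<le> t \<Longrightarrow> crearr f t \<le> crearr f s"
  unfolding crearr_def by (rule rearr_antimono)

lemma borel_measurable_crearr [measurable]: "crearr f \<in> borel_measurable (lebesgue_on {0<..})"
  unfolding crearr_def by measurable

lemma nn_integral_below_ge:
  fixes g :: "real \<Rightarrow> ennreal"
  assumes "\<And>t. 0 < t \<Longrightarrow> t \<le> a \<Longrightarrow> g a \<le> g t" "0 < a"
  shows "ennreal a * g a \<le> (\<integral>\<^sup>+t\<in>{0<..<a}. g t \<partial>lebesgue)"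
proof -
  have "ennreal a * g a = (\<integral>\<^sup>+t\<in>{0<..<a}. g a \<partial>lebesgue)"
    using assms(2) by (subst nn_integral_cmult_indicator) (auto simp: mult.commute)
  also have "\<dots> \<le> (\<integral>\<^sup>+t\<in>{0<..<a}. g t \<partial>lebesgue)"
    using assms(1) by (intro nn_integral_mono) (auto split: split_indicator)
  finally show ?thesis .
qed

text \<open>The set where the modulus of \<open>f\<close> exceeds \<open>l\<close>, the
  rearrangement at \<open>1/x\<close>, has measure at most \<open>1/x\<close>, so the large part
  costs one copy of \<open>?S\<close>. The rearrangement of the small part is at most
  \<open>l\<close> and at most that of \<open>f\<close>, so its energy is at most the square of
  \<open>l\<close> over \<open>x\<close>, plus \<open>?Q\<close>. Since \<open>l / x\<close> is at
  most \<open>?S\<close> by monotonicity, the first term costs the second copy.\<close>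

lemma crearr_fourier_le:
  fixes f :: "real ^ 'n \<Rightarrow> complex"
  assumes f: "integrable lebesgue f" and x: "0 < x"
  shows "crearr (fourier f) x \<le> 2 * (\<integral>\<^sup>+t\<in>{0<..<1/x}. crearr f t \<partial>lebesgue)
      + (ennreal (1/x) * (\<integral>\<^sup>+t\<in>{1/x<..}. (crearr f t)\<^sup>2 \<partial>lebesgue)) ennpow (1/2)"
    (is "_ \<le> 2 * ?S + (_ * ?Q) ennpow _")
proof -
  let ?a = "1/x"
  let ?F = "\<lambda>y. ennreal (norm (f y))"
  have a: "0 < ?a" using x by simp
  have [measurable]: "f \<in> borel_measurable lebesgue" using f by auto
  obtain l where l: "crearr f ?a = ennreal l" "0 \<le> l"
    using crearr_less_top[OF f a] by (cases "crearr f ?a") auto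
  define f1 where "f1 y = (if l < norm (f y) then f y else 0)" for y
  define f2 where "f2 y = (if l < norm (f y) then 0 else f y)" for y
  have [measurable]: "f1 \<in> borel_measurable lebesgue" "f2 \<in> borel_measurable lebesgue"
    unfolding f1_def[abs_def] f2_def[abs_def] by measurable
  have f1: "integrable lebesgue f1" and f2: "integrable lebesgue f2"
    by (auto intro!: Bochner_Integration.integrable_bound[OF f] simp: f1_def f2_def)
  let ?F2 = "\<lambda>y. ennreal (norm (f2 y))"
  let ?V = "\<integral>\<^sup>+y. ennreal ((norm (f2 y))\<^sup>2) \<partial>lebesgue"
  have S: "ennreal ?a * ennreal l \<le> ?S"
    using nn_integral_below_ge[of ?a "crearr f"] crearr_antimono[of _ ?a f] a l by simp

  let ?A = "{y \<in> space lebesgue. ennreal l < ?F y}"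
  have "emeasure lebesgue ?A \<le> ennreal ?a"
    using less_rearr_iff[of ?F lebesgue l ?a] l
    by (auto simp: distr_fun_def crearr_def simp del: space_completion space_lborel)
  moreover have A: "?A \<in> sets lebesgue"
    by measurable
  ultimately have "(\<integral>\<^sup>+t\<in>{0<..}. crearr f t
      * rearr lebesgue (indicator ?A) t \<partial>lebesgue) \<le> ?S"
    by (intro nn_integral_mult_rearr_indicator_le)
  moreover have "(\<integral>\<^sup>+y. ?F y * indicator ?A y \<partial>lebesgue)
      \<le> (\<integral>\<^sup>+t\<in>{0<..}. crearr f t * rearr lebesgue (indicator ?A) t \<partial>lebesgue)"
    unfolding crearr_def using A by (intro Hardy_Littlewood sigma_finite_lebesgue) auto
  moreover have "(\<integral>\<^sup>+y. ennreal (norm (f1 y)) \<partial>lebesgue)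
      = (\<integral>\<^sup>+y. ?F y * indicator ?A y \<partial>lebesgue)"
    using l by (intro nn_integral_cong) (auto simp: f1_def ennreal_less_iff split: split_indicator)
  ultimately have f1_le: "(\<integral>\<^sup>+y. ennreal (norm (f1 y)) \<partial>lebesgue) \<le> ?S"
    by simp

  have "?V = (\<integral>\<^sup>+y. ?F2 y * ?F2 y \<partial>lebesgue)"
    by (simp add: power2_eq_square ennreal_mult)
  also have "\<dots> \<le> (\<integral>\<^sup>+t\<in>{0<..}. rearr lebesgue ?F2 t * rearr lebesgue ?F2 t \<partial>lebesgue)"
    by (intro Hardy_Littlewood sigma_finite_lebesgue) auto
  also have "\<dots> \<le> (\<integral>\<^sup>+t. ennreal (l\<^sup>2) * indicator {0<..?a} t
      + (crearr f t)\<^sup>2 * indicator {?a<..} t \<partial>lebesgue)"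
  proof (intro nn_integral_mono)
    fix t
    have 1: "rearr lebesgue ?F2 t \<le> ennreal l"
      using l by (intro rearr_le) (auto simp: f2_def)
    have 2: "rearr lebesgue ?F2 t \<le> crearr f t"
      unfolding crearr_def by (intro rearr_mono) (auto simp: f2_def)
    show "rearr lebesgue ?F2 t * rearr lebesgue ?F2 t * indicator {0<..} t \<le>
        ennreal (l\<^sup>2) * indicator {0<..?a} t + (crearr f t)\<^sup>2 * indicator {?a<..} t"
      using mult_mono[OF 1 1] mult_mono[OF 2 2] a l
      by (auto split: split_indicator simp: power2_eq_square ennreal_mult not_less)
  qed
  also have "\<dots> = ennreal (l\<^sup>2) * ennreal ?a + ?Q"
  proof (subst nn_integral_add)
    \<comment> \<open>Measurability of \<open>crearr f\<close> is available on (0, \<infinity>); the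
      extra indicator changes no value and reduces the claim to that restricted space.\<close>
    have "(\<lambda>t. (crearr f t)\<^sup>2 * indicator {?a<..} t)
        = (\<lambda>t. ((crearr f t)\<^sup>2 * indicator {?a<..} t) * indicator {0<..} t)"
      using less_trans[OF a] by (auto split: split_indicator simp: fun_eq_iff)
    moreover have "\<dots> \<in> borel_measurable lebesgue"
    proof (subst borel_measurable_restrict_space_iff_ennreal[symmetric])
      have [measurable]: "{?a<..} \<in> sets (lebesgue_on {0<..})"
        using a by (auto simp: sets_restrict_space_iff)
      show "(\<lambda>t. (crearr f t)\<^sup>2 * indicator {?a<..} t) \<in> borel_measurable (lebesgue_on {0<..})"
        by measurable
    qed simp
    ultimately show "(\<lambda>t. (crearr f t)\<^sup>2 * indicator {?a<..} t) \<in> borel_measurable lebesgue"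
      by simp
    show "(\<integral>\<^sup>+t. ennreal (l\<^sup>2) * indicator {0<..?a} t \<partial>lebesgue) + ?Q
        = ennreal (l\<^sup>2) * ennreal ?a + ?Q"
      using a by (subst nn_integral_cmult_indicator) auto
  qed measurable
  finally have "ennreal ?a * ?V \<le> ennreal ?a * (ennreal (l\<^sup>2) * ennreal ?a + ?Q)"
    by (rule mult_left_mono) simp
  also have "\<dots> = (ennreal ?a * ennreal l)\<^sup>2 + ennreal ?a * ?Q"
    using l by (simp add: ring_distribs power2_eq_square ennreal_mult mult_ac)
  also have "\<dots> \<le> ?S\<^sup>2 + ennreal ?a * ?Q"
    using S by (intro add_right_mono power_mono) auto
  finally have "(ennreal ?a * ?V) ennpow (1/2) \<le> (?S\<^sup>2 + ennreal ?a * ?Q) ennpow (1/2)"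
    by (intro ennpow_mono) auto
  also have "\<dots> \<le> ?S + (ennreal ?a * ?Q) ennpow (1/2)"
    by (rule ennpow_half_add_le)
  finally have "(ennreal ?a * ?V) ennpow (1/2) \<le> ?S + (ennreal ?a * ?Q) ennpow (1/2)" .
  moreover have "crearr (fourier f) x \<le> (\<integral>\<^sup>+y. ennreal (norm (f1 y)) \<partial>lebesgue)
      + (ennreal ?a * ?V) ennpow (1/2)"
    by (rule crearr_fourier_weak_type[OF f f1 f2 _ x]) (simp add: f1_def f2_def)
  ultimately have "crearr (fourier f) x \<le> ?S + (?S + (ennreal ?a * ?Q) ennpow (1/2))"
    using f1_le by (meson add_mono order_trans)
  then show ?thesis
    by (simp add: mult_2 add.assoc)
qed

section \<open>From the square tail to the operator of condition (1)\<close>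

lemma powr_minus_half:
  fixes t :: real
  assumes "0 < t"
  shows "t powr - (1/2) = 1 / sqrt t"
  unfolding powr_minus using assms by (simp add: powr_half_sqrt inverse_eq_divide)

text \<open>The bracket on the right dominates \<open>sqrt t * g t\<close> for every
  \<open>t\<close> beyond \<open>a\<close>. Splitting the square of \<open>g t\<close> into
  \<open>t powr (-1/2) * g t\<close> and \<open>sqrt t * g t\<close> and bounding the second factor
  leaves the tail integral times the bracket.\<close>

lemma tail_square_le:
  fixes g :: "real \<Rightarrow> ennreal"
  assumes anti: "\<And>s t. 0 < s \<Longrightarrow> s \<le> t \<Longrightarrow> g t \<le> g s" and a: "0 < a"
  shows "(\<integral>\<^sup>+t\<in>{a<..}. (g t)\<^sup>2 \<partial>lebesgue)
    \<le> (ennreal (sqrt a) * g a + (\<integral>\<^sup>+t\<in>{a<..}. ennreal (t powr (-1/2))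
        * g t \<partial>lebesgue))\<^sup>2"
    (is "_ \<le> (_ + ?I)\<^sup>2")
proof -
  let ?M = "ennreal (sqrt a) * g a + ?I"
  have [measurable]: "g \<in> borel_measurable (lebesgue_on {0<..})"
    by (rule borel_measurable_antimono_on_lebesgue[OF anti])
  note rsqrt = powr_minus_half
  have le: "ennreal (sqrt t) * g t \<le> ?M" if t: "a < t" for t
  proof -
    \<comment> \<open>The quotient is the integral of the constant \<open>t powr (-1/2)\<close> over
      (a, t). Both that power and \<open>g\<close> are non-increasing, so multiplying by
      \<open>g t\<close> stays below the tail integral.\<close>
    have "sqrt t - sqrt a \<le> (t - a) / sqrt t"
      using a t mult_left_mono[of "sqrt a" "sqrt t" "sqrt a"] by (simp add: field_simps)
    then have "ennreal (sqrt t - sqrt a) * g t \<le> ennreal (t powr (-1/2) * (t - a)) * g t"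
      using a t by (intro mult_right_mono ennreal_leI) (auto simp: rsqrt)
    also have "\<dots> = (\<integral>\<^sup>+s\<in>{a<..<t}. ennreal (t powr (-1/2)) * g t \<partial>lebesgue)"
      using a t by (subst nn_integral_cmult_indicator) (auto simp: ennreal_mult mult_ac)
    also have "\<dots> \<le> ?I"
    proof (rule nn_integral_mono)
      fix s
      show "ennreal (t powr (-1/2)) * g t * indicator {a<..<t} s \<le> ennreal (s powr (-1/2)) * g s * indicator {a<..} s"
        using a t anti[of s t] by (auto split: split_indicator intro!: mult_mono ennreal_leI powr_mono2')
    qed
    finally have 1: "ennreal (sqrt t - sqrt a) * g t \<le> ?I" .
    have "ennreal (sqrt t) * g t = ennreal (sqrt a + (sqrt t - sqrt a)) * g t"
      by simp
    also have "\<dots> = ennreal (sqrt a) * g t + ennreal (sqrt t - sqrt a) * g t"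
      using a t by (subst ennreal_plus) (auto simp: ring_distribs)
    also have "\<dots> \<le> ?M"
      using a t 1 anti[of a t] by (intro add_mono mult_left_mono) auto
    finally show ?thesis .
  qed
  have "(\<integral>\<^sup>+t\<in>{a<..}. (g t)\<^sup>2 \<partial>lebesgue)
      \<le> (\<integral>\<^sup>+t. (ennreal (t powr (-1/2)) * g t * indicator {a<..} t) * ?M \<partial>lebesgue)"
  proof (rule nn_integral_mono)
    fix t
    have "(g t)\<^sup>2 \<le> ennreal (t powr (-1/2)) * g t * ?M" if t: "a < t"
    proof -
      have "(g t)\<^sup>2 = ennreal (t powr (-1/2) * sqrt t) * (g t)\<^sup>2"
        using a t by (simp add: rsqrt)
      also have "\<dots> = ennreal (t powr (-1/2)) * g t * (ennreal (sqrt t) * g t)"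
        using a t by (simp add: ennreal_mult power2_eq_square mult_ac)
      also have "\<dots> \<le> ennreal (t powr (-1/2)) * g t * ?M"
        using le[OF t] by (intro mult_left_mono) auto
      finally show ?thesis .
    qed
    then show "(g t)\<^sup>2 * indicator {a<..} t \<le> (ennreal (t powr (-1/2)) * g t * indicator {a<..} t) * ?M"
      by (auto split: split_indicator)
  qed
  also have "\<dots> = ?I * ?M"
  proof (rule nn_integral_multc)
    have "(\<lambda>t. ennreal (t powr (-1/2)) * g t * indicator {a<..} t)
        = (\<lambda>t. (ennreal (t powr (-1/2)) * g t * indicator {a<..} t) * indicator {0<..} t)"
      using less_trans[OF a] by (auto split: split_indicator simp: fun_eq_iff)
    moreover have "\<dots> \<in> borel_measurable lebesgue"
    proof (subst borel_measurable_restrict_space_iff_ennreal[symmetric])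
      have [measurable]: "{a<..} \<in> sets (lebesgue_on {0<..})"
        using a by (auto simp: sets_restrict_space_iff)
      have [measurable]: "(\<lambda>t::real. t) \<in> borel_measurable (lebesgue_on {0<..})"
        by (rule measurable_restrict_space1) measurable
      show "(\<lambda>t. ennreal (t powr (-1/2)) * g t * indicator {a<..} t) \<in> borel_measurable (lebesgue_on {0<..})"
        by measurable
    qed simp
    ultimately show "(\<lambda>t. ennreal (t powr (-1/2)) * g t * indicator {a<..} t) \<in> borel_measurable lebesgue"
      by simp
  qed
  also have "\<dots> \<le> ?M * ?M"
    by (intro mult_right_mono) auto
  finally show ?thesis
    by (simp add: power2_eq_square)
qed

text \<open>The factor \<open>1/x\<close> is the square of \<open>x powr (-1/2)\<close>, which
  enters the bracket of \<open>tail_square_le\<close> and turns its boundary term into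
  \<open>g (1/x)\<close> over \<open>x\<close>; monotonicity bounds this by the integral over (0,
  1/x).\<close>

lemma sqrt_tail_square_le:
  fixes g :: "real \<Rightarrow> ennreal"
  assumes anti: "\<And>s t. 0 < s \<Longrightarrow> s \<le> t \<Longrightarrow> g t \<le> g s" and x: "0 < x"
  shows "(ennreal (1/x) * (\<integral>\<^sup>+t\<in>{1/x<..}. (g t)\<^sup>2 \<partial>lebesgue)) ennpow (1/2)
    \<le> (\<integral>\<^sup>+t\<in>{0<..<1/x}. g t \<partial>lebesgue)
      + ennreal (x powr (-1/2)) * (\<integral>\<^sup>+t\<in>{1/x<..}. ennreal (t powr (-1/2)) * g t \<partial>lebesgue)"
    (is "_ \<le> ?S + _ * ?I")
proof -
  let ?r = "ennreal (x powr (-1/2))"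
  have r: "x powr (-1/2) = sqrt (1/x)"
    using x by (simp add: powr_minus_half real_sqrt_divide)
  then have r2: "ennreal (1/x) = ?r * ?r"
    using x by (simp flip: ennreal_mult)
  have S: "ennreal (1/x) * g (1/x) \<le> ?S"
    using x by (intro nn_integral_below_ge anti) auto
  have "ennreal (1/x) * (\<integral>\<^sup>+t\<in>{1/x<..}. (g t)\<^sup>2 \<partial>lebesgue)
      \<le> ennreal (1/x) * (?r * g (1/x) + ?I)\<^sup>2"
    using tail_square_le[of g "1/x"] anti x unfolding r by (intro mult_left_mono) auto
  also have "\<dots> = (ennreal (1/x) * g (1/x) + ?r * ?I)\<^sup>2"
    by (simp add: r2 power2_eq_square ring_distribs mult_ac)
  also have "\<dots> \<le> (?S + ?r * ?I)\<^sup>2"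
    using S by (intro power_mono add_right_mono) auto
  finally have "(ennreal (1/x) * (\<integral>\<^sup>+t\<in>{1/x<..}. (g t)\<^sup>2 \<partial>lebesgue)) ennpow (1/2) \<le> ((?S + ?r * ?I) ennpow 2) ennpow (1/2)"
    by (intro ennpow_mono) (auto simp: ennpow_2)
  then show ?thesis
    by (simp add: ennpow_ennpow)
qed

section \<open>Weighted norms and the final estimates\<close>

text \<open>A quasi-triangle inequality for every positive \<open>q\<close>:
  \<open>ennpow_add_le\<close> is used with exponent \<open>q\<close> under the integral and with
  \<open>1/q\<close> outside. The first use doubles the coefficients 3 and 1; the second contributes
  the outer constant.\<close>

lemma weighted_norm_add_le:
  fixes A B F v :: "'a \<Rightarrow> ennreal"
  assumes q: "0 < q"
    and [measurable]: "A \<in> borel_measurable M" "B \<in> borel_measurable M" "v \<in> borel_measurable M"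
    and F: "\<And>x. x \<in> space M \<Longrightarrow> F x \<le> 3 * A x + B x"
  shows "(\<integral>\<^sup>+x. F x ennpow q * v x \<partial>M) ennpow (1/q)
    \<le> ennreal (2 powr (1/q)) * (6 * (\<integral>\<^sup>+x. A x ennpow q * v x \<partial>M) ennpow (1/q)
        + 2 * (\<integral>\<^sup>+x. B x ennpow q * v x \<partial>M) ennpow (1/q))"
proof -
  let ?A = "\<integral>\<^sup>+x. A x ennpow q * v x \<partial>M" and ?B
      = "\<integral>\<^sup>+x. B x ennpow q * v x \<partial>M"
  have "(\<integral>\<^sup>+x. F x ennpow q * v x \<partial>M)
      \<le> (\<integral>\<^sup>+x. ennreal (6 powr q) * (A x ennpow q * v x)
          + ennreal (2 powr q) * (B x ennpow q * v x) \<partial>M)"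
  proof (rule nn_integral_mono)
    fix x assume x: "x \<in> space M"
    have "F x ennpow q \<le> (3 * A x + B x) ennpow q"
      using F[OF x] q by (intro ennpow_mono) auto
    also have "\<dots> \<le> ennreal (2 powr q) * ((3 * A x) ennpow q + B x ennpow q)"
      using q by (rule ennpow_add_le)
    also have "(3 * A x) ennpow q = ennreal (3 powr q) * A x ennpow q"
      using q ennpow_ennreal[of 3 q] by (simp add: ennpow_mult)
    also have "ennreal (2 powr q) * (ennreal (3 powr q) * A x ennpow q + B x ennpow q)
        = ennreal (6 powr q) * A x ennpow q + ennreal (2 powr q) * B x ennpow q"
      using powr_mult[of 2 3 q] by (simp add: ring_distribs ennreal_mult flip: mult.assoc)
    finally have "F x ennpow q * v x \<le> (ennreal (6 powr q) * A x ennpow q + ennreal (2 powr q) * B x ennpow q) * v x"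
      by (rule mult_right_mono) simp
    then show "F x ennpow q * v x \<le> ennreal (6 powr q) * (A x ennpow q * v x)
        + ennreal (2 powr q) * (B x ennpow q * v x)"
      by (simp add: ring_distribs mult_ac)
  qed
  also have "\<dots> = ennreal (6 powr q) * ?A + ennreal (2 powr q) * ?B"
    by (simp add: nn_integral_add nn_integral_cmult)
  finally have "(\<integral>\<^sup>+x. F x ennpow q * v x \<partial>M) ennpow (1/q)
      \<le> (ennreal (6 powr q) * ?A + ennreal (2 powr q) * ?B) ennpow (1/q)"
    using q by (intro ennpow_mono) auto
  also have "\<dots> \<le> ennreal (2 powr (1/q)) * ((ennreal (6 powr q) * ?A) ennpow (1/q)
      + (ennreal (2 powr q) * ?B) ennpow (1/q))"
    using q by (intro ennpow_add_le) auto
  also have "(ennreal (6 powr q) * ?A) ennpow (1/q) = 6 * ?A ennpow (1/q)"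
    using q by (simp add: ennpow_mult ennpow_ennreal powr_powr)
  also have "(ennreal (2 powr q) * ?B) ennpow (1/q) = 2 * ?B ennpow (1/q)"
    using q by (simp add: ennpow_mult ennpow_ennreal powr_powr)
  finally show ?thesis .
qed

lemma set_nn_integral_Ioi_cong:
  "(\<And>t. (0::real) < t \<Longrightarrow> f t = g t)
      \<Longrightarrow> (\<integral>\<^sup>+t\<in>{0<..}. f t \<partial>lebesgue)
      = (\<integral>\<^sup>+t\<in>{0<..}. g t \<partial>lebesgue)"
  by (intro nn_integral_cong) (auto split: split_indicator)

lemma one_divide_one_divide_ennreal: "1 / (1 / x) = (x::ennreal)"
proof (cases x)
  case (real r)
  then show ?thesis
    by (cases "r = 0") (auto simp: divide_ennreal_def inverse_ennreal)
qed (simp add: divide_ennreal_def)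

theorem theorem2p2:
  fixes U W :: "real ^ 'n \<Rightarrow> ennreal"
    and u w :: "real \<Rightarrow> ennreal"
    and p q :: real
  assumes U: "U \<in> borel_measurable lebesgue"
    and W: "W \<in> borel_measurable lebesgue"
    and u: "\<And>t. t > 0 \<Longrightarrow> u t = rearr lebesgue U t"
    and w: "\<And>t. t > 0 \<Longrightarrow> 1 / w t = rearr lebesgue (\<lambda>x. 1 / W x) t"
    and p: "1 < p"
    and q: "0 < q" "q < p"
    and hardy: "\<exists>C\<^sub>1 < \<infinity>. \<forall>f :: real \<Rightarrow> real.
        f \<in> borel_measurable (lebesgue_on {0<..}) \<longrightarrow> (\<forall>t>0. 0 \<le> f t) \<longrightarrow>
        (\<integral>\<^sup>+ t\<in>{0<..}. ((\<integral>\<^sup>+ s\<in>{0<..<1/t}. ennreal (f s) \<partial>lebesgue) ennpow q * u t) \<partial>lebesgue)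
            ennpow (1/q)
          \<le> C\<^sub>1 * (\<integral>\<^sup>+ s\<in>{0<..}. (ennreal (f s) ennpow p * w s) \<partial>lebesgue) ennpow (1/p)"
    and "(\<exists>C\<^sub>2 < \<infinity>. \<forall>f :: real ^ 'n \<Rightarrow> complex. integrable lebesgue f \<longrightarrow>
          (\<integral>\<^sup>+ x\<in>{0<..}. ((ennreal (x powr (-1/2)) *
              (\<integral>\<^sup>+ t\<in>{1/x<..}. (ennreal (t powr (-1/2)) * crearr f t) \<partial>lebesgue)) ennpow q * u x)
              \<partial>lebesgue) ennpow (1/q)
            \<le> C\<^sub>2 * (\<integral>\<^sup>+ s\<in>{0<..}. (crearr f s ennpow p * w s) \<partial>lebesgue) ennpow (1/p))
       \<or> (\<exists>C\<^sub>3 < \<infinity>. \<forall>f :: real ^ 'n \<Rightarrow> complex. integrable lebesgue f \<longrightarrow>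
          (\<integral>\<^sup>+ x\<in>{0<..}. ((ennreal (1/x) *
              (\<integral>\<^sup>+ t\<in>{1/x<..}. (crearr f t)\<^sup>2 \<partial>lebesgue)) ennpow (q/2) * u x)
              \<partial>lebesgue) ennpow (1/q)
            \<le> C\<^sub>3 * (\<integral>\<^sup>+ s\<in>{0<..}. (crearr f s ennpow p * w s) \<partial>lebesgue) ennpow (1/p))"
  shows "\<exists>C < \<infinity>.
      (\<forall>f :: real ^ 'n \<Rightarrow> complex. integrable lebesgue f \<longrightarrow>
          (\<integral>\<^sup>+ t\<in>{0<..}. (crearr (fourier f) t ennpow q * u t) \<partial>lebesgue) ennpow (1/q)
            \<le> C * (\<integral>\<^sup>+ s\<in>{0<..}. (crearr f s ennpow p * w s) \<partial>lebesgue) ennpow (1/p))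
    \<and> (\<forall>f :: real ^ 'n \<Rightarrow> complex. integrable lebesgue f \<longrightarrow>
          (\<integral>\<^sup>+ y. (ennreal (norm (fourier f y)) ennpow q * U y) \<partial>lebesgue) ennpow (1/q)
            \<le> C * (\<integral>\<^sup>+ x. (ennreal (norm (f x)) ennpow p * W x) \<partial>lebesgue) ennpow (1/p))"
proof -
  let ?N = "\<lambda>f :: real ^ 'n \<Rightarrow> complex. (\<integral>\<^sup>+ s\<in>{0<..}. (crearr f s ennpow p
      * w s) \<partial>lebesgue) ennpow (1/p)"
  let ?S = "\<lambda>(f :: real ^ 'n \<Rightarrow> complex) x. \<integral>\<^sup>+ t\<in>{0<..<1/x}. crearr f t \<partial>lebesgue"
  let ?R1 = "\<lambda>(f :: real ^ 'n \<Rightarrow> complex) x. ennreal (x powr (-1/2)) *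
              (\<integral>\<^sup>+ t\<in>{1/x<..}. (ennreal (t powr (-1/2)) * crearr f t) \<partial>lebesgue)"
  let ?J = "\<lambda>(f :: real ^ 'n \<Rightarrow> complex) x. ennreal (1/x)
      * (\<integral>\<^sup>+ t\<in>{1/x<..}. (crearr f t)\<^sup>2 \<partial>lebesgue)"
  have [measurable]: "(\<lambda>t::real. t) \<in> borel_measurable (lebesgue_on {0<..})"
    by (rule measurable_restrict_space1) measurable
  have u_meas [measurable]: "u \<in> borel_measurable (lebesgue_on {0<..})"
    by (rule borel_measurable_antimono_on_lebesgue) (auto simp: u rearr_antimono)
  \<comment> \<open>Taking reciprocals is an involution on [0, \<infinity>], so \<open>w\<close>
    inherits measurability from a rearrangement.\<close>
  have w_eq: "w t = 1 / rearr lebesgue (\<lambda>x. 1 / W x) t" if "0 < t" for t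
    unfolding w[OF that, symmetric] by (simp add: one_divide_one_divide_ennreal)
  have w_meas: "w \<in> borel_measurable (lebesgue_on {0<..})"
    by (subst measurable_cong[OF w_eq]) auto
  have S_meas [measurable]: "?S f \<in> borel_measurable (lebesgue_on {0<..})" for f
  proof (rule borel_measurable_antimono_on_lebesgue, rule nn_integral_mono)
    fix s t x :: real assume "0 < s" "s \<le> t"
    then have "1 / t \<le> 1 / s" by (simp add: frac_le)
    then show "crearr f x * indicator {0<..<1/t} x \<le> crearr f x * indicator {0<..<1/s} x"
      by (auto split: split_indicator)
  qed
  have tail_meas [measurable]: "(\<lambda>x. \<integral>\<^sup>+ t\<in>{1/x<..}. h t \<partial>lebesgue)
      \<in> borel_measurable (lebesgue_on {0<..})"
    for h :: "real \<Rightarrow> ennreal"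
  proof (rule borel_measurable_mono_on_lebesgue, rule nn_integral_mono)
    fix s t x :: real assume "0 < s" "s \<le> t"
    then have "1 / t \<le> 1 / s" by (simp add: frac_le)
    then show "h x * indicator {1/s<..} x \<le> h x * indicator {1/t<..} x"
      by (auto split: split_indicator)
  qed
  have R1_meas: "?R1 f \<in> borel_measurable (lebesgue_on {0<..})" for f
    by measurable
  have J_meas: "(\<lambda>x. ?J f x ennpow (1/2)) \<in> borel_measurable (lebesgue_on {0<..})" for f
    by measurable

  obtain C1 where C1: "C1 < \<infinity>" "\<And>f :: real ^ 'n \<Rightarrow> complex. integrable lebesgue f \<Longrightarrow>
      (\<integral>\<^sup>+ x\<in>{0<..}. (?S f x ennpow q * u x) \<partial>lebesgue) ennpow (1/q) \<le> C1 * ?N f"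
  proof -
    from hardy obtain C1 where "C1 < \<infinity>" and C1: "\<And>f :: real \<Rightarrow> real.
        f \<in> borel_measurable (lebesgue_on {0<..}) \<Longrightarrow> (\<forall>t>0. 0 \<le> f t) \<Longrightarrow>
        (\<integral>\<^sup>+ t\<in>{0<..}. ((\<integral>\<^sup>+ s\<in>{0<..<1/t}. ennreal (f s) \<partial>lebesgue) ennpow q * u t) \<partial>lebesgue)
            ennpow (1/q)
          \<le> C1 * (\<integral>\<^sup>+ s\<in>{0<..}. (ennreal (f s) ennpow p * w s) \<partial>lebesgue) ennpow (1/p)"
      by blast
    have "(\<integral>\<^sup>+ x\<in>{0<..}. (?S f x ennpow q * u x) \<partial>lebesgue) ennpow (1/q) \<le> C1 * ?N f"
      if f: "integrable lebesgue f" for f :: "real ^ 'n \<Rightarrow> complex"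
    proof -
      \<comment> \<open>The Hardy hypothesis concerns real-valued functions. The rearrangement of an
        integrable function is finite at positive arguments, so the conversion changes no value
        there.\<close>
      let ?h = "\<lambda>t. enn2real (crearr f t)"
      have h: "ennreal (?h t) = crearr f t" if "0 < t" for t
        using crearr_less_top[OF f that] by simp
      have "(\<integral>\<^sup>+ s\<in>{0<..<1/t}. ennreal (?h s) \<partial>lebesgue) = ?S f t" for t
        by (intro nn_integral_cong) (auto split: split_indicator simp: h)
      moreover have "(\<integral>\<^sup>+ s\<in>{0<..}. (ennreal (?h s) ennpow p * w s) \<partial>lebesgue) =
          (\<integral>\<^sup>+ s\<in>{0<..}. (crearr f s ennpow p * w s) \<partial>lebesgue)"
        by (rule set_nn_integral_Ioi_cong) (simp only: h)
      moreover have "?h \<in> borel_measurable (lebesgue_on {0<..})"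
        by measurable
      ultimately show ?thesis
        using C1[of ?h] by simp
    qed
    with \<open>C1 < \<infinity>\<close> show ?thesis by (rule that)
  qed

  \<comment> \<open>The coefficient is raised from 2 to 3 to match \<open>pw1\<close>, where the
    tail contributes a third copy of \<open>?S f x\<close>.\<close>
  have pw: "crearr (fourier f) x \<le> 3 * ?S f x + ?J f x ennpow (1/2)" 
    if "integrable lebesgue f" "0 < x" for f :: "real ^ 'n \<Rightarrow> complex" and x
    using crearr_fourier_le[OF that] by (rule order_trans) (auto intro!: add_right_mono mult_right_mono)
  have pw1: "crearr (fourier f) x \<le> 3 * ?S f x + ?R1 f x" 
    if "integrable lebesgue f" "0 < x" for f :: "real ^ 'n \<Rightarrow> complex" and x
  proof -
    have "crearr (fourier f) x \<le> 2 * ?S f x + ?J f x ennpow (1/2)"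
      by (rule crearr_fourier_le[OF that])
    also have "\<dots> \<le> 2 * ?S f x + (?S f x + ?R1 f x)"
      by (intro add_left_mono sqrt_tail_square_le crearr_antimono that)
    also have "\<dots> = (2 + 1) * ?S f x + ?R1 f x"
      by (simp only: ring_distribs add.assoc mult_1)
    finally show ?thesis by simp
  qed

  \<comment> \<open>Both conditions take one form: a remainder \<open>R\<close> with controlled
    weighted norm, namely the operator of condition (1) or the square root of
    \<open>?J f\<close>.\<close>
  have "\<exists>C2 < \<infinity>. \<forall>f :: real ^ 'n \<Rightarrow> complex. integrable lebesgue f \<longrightarrow>
      (\<exists>R. R \<in> borel_measurable (lebesgue_on {0<..}) \<and>
        (\<forall>x>0. crearr (fourier f) x \<le> 3 * ?S f x + R x) \<and>
        (\<integral>\<^sup>+ x\<in>{0<..}. (R x ennpow q * u x) \<partial>lebesgue) ennpow (1/q) \<le> C2 * ?N f)"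
    using assms(9)
  proof (elim disjE exE conjE)
    fix C2 assume "C2 < \<infinity>" and C2: "\<forall>f :: real ^ 'n \<Rightarrow> complex. integrable lebesgue f \<longrightarrow>
      (\<integral>\<^sup>+ x\<in>{0<..}. (?R1 f x ennpow q * u x) \<partial>lebesgue) ennpow (1/q) \<le> C2 * ?N f"
    have "\<forall>f :: real ^ 'n \<Rightarrow> complex. integrable lebesgue f \<longrightarrow>
      (\<exists>R. R \<in> borel_measurable (lebesgue_on {0<..}) \<and>
        (\<forall>x>0. crearr (fourier f) x \<le> 3 * ?S f x + R x) \<and>
        (\<integral>\<^sup>+ x\<in>{0<..}. (R x ennpow q * u x) \<partial>lebesgue) ennpow (1/q) \<le> C2 * ?N f)"
    proof (intro allI impI)
      fix f :: "real ^ 'n \<Rightarrow> complex" assume f: "integrable lebesgue f"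
      show "\<exists>R. R \<in> borel_measurable (lebesgue_on {0<..}) \<and>
        (\<forall>x>0. crearr (fourier f) x \<le> 3 * ?S f x + R x) \<and>
        (\<integral>\<^sup>+ x\<in>{0<..}. (R x ennpow q * u x) \<partial>lebesgue) ennpow (1/q) \<le> C2 * ?N f"
        using R1_meas[of f] pw1[OF f] C2[rule_format, OF f] by (intro exI[of _ "?R1 f"] conjI allI impI)
    qed
    with \<open>C2 < \<infinity>\<close> show ?thesis by blast
  next
    fix C3 assume "C3 < \<infinity>" and C3: "\<forall>f :: real ^ 'n \<Rightarrow> complex. integrable lebesgue f \<longrightarrow>
      (\<integral>\<^sup>+ x\<in>{0<..}. (?J f x ennpow (q/2) * u x) \<partial>lebesgue) ennpow (1/q) \<le> C3 * ?N f"
    have "\<forall>f :: real ^ 'n \<Rightarrow> complex. integrable lebesgue f \<longrightarrow>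
      (\<exists>R. R \<in> borel_measurable (lebesgue_on {0<..}) \<and>
        (\<forall>x>0. crearr (fourier f) x \<le> 3 * ?S f x + R x) \<and>
        (\<integral>\<^sup>+ x\<in>{0<..}. (R x ennpow q * u x) \<partial>lebesgue) ennpow (1/q) \<le> C3 * ?N f)"
    proof (intro allI impI)
      fix f :: "real ^ 'n \<Rightarrow> complex" assume f: "integrable lebesgue f"
      have "(\<integral>\<^sup>+ x\<in>{0<..}. ((?J f x ennpow (1/2)) ennpow q
          * u x) \<partial>lebesgue) ennpow (1/q) \<le> C3 * ?N f"
        using C3[rule_format, OF f] by (simp add: ennpow_ennpow)
      then show "\<exists>R. R \<in> borel_measurable (lebesgue_on {0<..}) \<and>
        (\<forall>x>0. crearr (fourier f) x \<le> 3 * ?S f x + R x) \<and>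
        (\<integral>\<^sup>+ x\<in>{0<..}. (R x ennpow q * u x) \<partial>lebesgue) ennpow (1/q) \<le> C3 * ?N f"
        using J_meas[of f] pw[OF f] by (intro exI[of _ "\<lambda>x. ?J f x ennpow (1/2)"] conjI allI impI)
    qed
    with \<open>C3 < \<infinity>\<close> show ?thesis by blast
  qed
  then obtain C2 where C2: "C2 < \<infinity>" "\<And>f :: real ^ 'n \<Rightarrow> complex. integrable lebesgue f \<Longrightarrow>
      (\<exists>R. R \<in> borel_measurable (lebesgue_on {0<..}) \<and>
        (\<forall>x>0. crearr (fourier f) x \<le> 3 * ?S f x + R x) \<and>
        (\<integral>\<^sup>+ x\<in>{0<..}. (R x ennpow q * u x) \<partial>lebesgue) ennpow (1/q) \<le> C2 * ?N f)"
    by blast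

  \<comment> \<open>The constant collects the two coefficients from
    \<open>weighted_norm_add_le\<close>, applied to the Hardy term and to the remainder.\<close>
  define C where "C = ennreal (2 powr (1/q)) * (6 * C1 + 2 * C2)"
  have "C < \<infinity>"
    using C1(1) C2(1) by (simp add: C_def ennreal_mult_less_top)
  have rearranged: "(\<integral>\<^sup>+ t\<in>{0<..}. (crearr (fourier f) t ennpow q
      * u t) \<partial>lebesgue) ennpow (1/q) \<le> C * ?N f"
    if f: "integrable lebesgue f" for f :: "real ^ 'n \<Rightarrow> complex"
  proof -
    obtain R where R [measurable]: "R \<in> borel_measurable (lebesgue_on {0<..})"
      and le: "\<And>x. 0 < x \<Longrightarrow> crearr (fourier f) x \<le> 3 * ?S f x + R x"
      and R_le: "(\<integral>\<^sup>+ x\<in>{0<..}. (R x ennpow q * u x) \<partial>lebesgue) ennpow (1/q) \<le> C2 * ?N f"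
      using C2(2)[OF f] by blast
    have "(\<integral>\<^sup>+ t\<in>{0<..}. (crearr (fourier f) t ennpow q * u t) \<partial>lebesgue) ennpow (1/q)
        \<le> ennreal (2 powr (1/q)) * (6 * (\<integral>\<^sup>+ x\<in>{0<..}. (?S f x ennpow q
            * u x) \<partial>lebesgue) ennpow (1/q)
          + 2 * (\<integral>\<^sup>+ x\<in>{0<..}. (R x ennpow q * u x) \<partial>lebesgue) ennpow (1/q))"
      using weighted_norm_add_le[OF q(1) S_meas R u_meas, of "crearr (fourier f)" f] le
      by (simp add: nn_set_integral_lebesgue_on)
    also have "\<dots> \<le> ennreal (2 powr (1/q)) * (6 * (C1 * ?N f) + 2 * (C2 * ?N f))"
      by (intro mult_left_mono add_mono C1(2)[OF f] R_le) auto
    also have "\<dots> = C * ?N f"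
      by (simp add: C_def ring_distribs mult.assoc)
    finally show ?thesis .
  qed
  have "(\<integral>\<^sup>+ y. (ennreal (norm (fourier f y)) ennpow q * U y) \<partial>lebesgue) ennpow (1/q)
            \<le> C * (\<integral>\<^sup>+ x. (ennreal (norm (f x)) ennpow p * W x) \<partial>lebesgue) ennpow (1/p)"
    if f: "integrable lebesgue f" for f :: "real ^ 'n \<Rightarrow> complex"
  proof -
    have [measurable]: "f \<in> borel_measurable lebesgue" using f by auto
    note [measurable] = borel_measurable_fourier[OF f] U W
    \<comment> \<open>Powers commute with rearrangement, so \<open>Hardy_Littlewood\<close> for the
      power of the transform against \<open>U\<close> lands exactly on the rearranged left
      side.\<close>
    have rU: "rearr lebesgue (\<lambda>y. ennreal (norm (fourier f y)) ennpow q) t = crearr (fourier f) t ennpow q" for t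
      unfolding crearr_def using q by (intro rearr_ennpow) auto
    have rW: "rearr lebesgue (\<lambda>y. ennreal (norm (f y)) ennpow p) t = crearr f t ennpow p" for t
      unfolding crearr_def using p by (intro rearr_ennpow) auto
    have "(\<integral>\<^sup>+ y. (ennreal (norm (fourier f y)) ennpow q * U y) \<partial>lebesgue)
        \<le> (\<integral>\<^sup>+ t\<in>{0<..}. rearr lebesgue (\<lambda>y. ennreal (norm (fourier f y)) ennpow q) t * rearr lebesgue U t \<partial>lebesgue)"
      by (intro Hardy_Littlewood sigma_finite_lebesgue) measurable
    also have "\<dots> = (\<integral>\<^sup>+ t\<in>{0<..}. (crearr (fourier f) t ennpow q * u t) \<partial>lebesgue)"
      by (rule set_nn_integral_Ioi_cong) (simp only: rU u)
    finally have "(\<integral>\<^sup>+ y. (ennreal (norm (fourier f y)) ennpow q * U y) \<partial>lebesgue) ennpow (1/q)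
        \<le> (\<integral>\<^sup>+ t\<in>{0<..}. (crearr (fourier f) t ennpow q * u t) \<partial>lebesgue) ennpow (1/q)"
      using q by (intro ennpow_mono) auto
    also have "\<dots> \<le> C * ?N f"
      by (rule rearranged[OF f])
    \<comment> \<open>On the right the passage goes back from rearrangements to functions:
      \<open>w\<close> is the non-decreasing rearrangement of \<open>W\<close>, so the reverse
      inequality applies.\<close>
    also have "(\<integral>\<^sup>+ s\<in>{0<..}. (crearr f s ennpow p * w s) \<partial>lebesgue)
        \<le> (\<integral>\<^sup>+ x. (ennreal (norm (f x)) ennpow p * W x) \<partial>lebesgue)"
      unfolding rW[symmetric] by (intro Hardy_Littlewood_reverse sigma_finite_lebesgue w w_meas) measurable
    then have "C * ?N f \<le> C * (\<integral>\<^sup>+ x. (ennreal (norm (f x)) ennpow p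
        * W x) \<partial>lebesgue) ennpow (1/p)"
      using p by (intro mult_left_mono ennpow_mono) auto
    finally show ?thesis .
  qed
  with \<open>C < \<infinity>\<close> rearranged show ?thesis by blast
qed

end
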